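(* Fix $s\in\mathbb{C}$ with $\sigma=\Re(s)>\frac12$. For $y=y_1+iy_2$ with $y_1,y_2\in\mathbb{R}$, let $\widetilde{M}_s(y_1,y_2)$ be defined in (Case 1) by $$\widetilde{M}_s(y_1,y_2)=\exp\left(-i\Re\left(\bar y\log(1-3^{-s})\right)\right)\prod_{\mathfrak{p}\nmid\langle 3\rangle}\left(\frac{1}{\mathrm{N}(\mathfrak{p})+1}+\frac13\frac{\mathrm{N}(\mathfrak{p})}{\mathrm{N}(\mathfrak{p})+1}\sum_{j=0}^{2}\exp\left(-i\Re\left(\bar y\log\left(1-\frac{\zeta_3^{\,j}}{\mathrm{N}(\mathfrak{p})^{s}}\right)\right)\right)\right)$$ and in (Case 2) by $$\widetilde{M}_s(y_1,y_2)=\exp\left(-i\Re\left(\frac{\bar y\log 3}{3^{s}-1}\right)\right)\prod_{\mathfrak{p}\nmid\langle 3\rangle}\left(\frac{1}{\mathrm{N}(\mathfrak{p})+1}+\frac13\frac{\mathrm{N}(\mathfrak{p})}{\mathrm{N}(\mathfrak{p})+1}\sum_{j=0}^{2}\exp\left(-i\Re\left(\frac{\bar y\,\zeta_3^{\,j}\log\mathrm{N}(\mathfrak{p})}{\mathrm{N}(\mathfrak{p})^{s}-\zeta_3^{\,j}}\right)\right)\right).$$ Then there are positive constants $C_1$ and $C_2$, depending only on $\sigma$, such that as $|y|\to\infty$ (i.e. for all $y$ with $|y|$ sufficiently large), $$\left|\widetilde{M}_s(y_1,y_2)\right|\le\begin{cases}\exp\left(-C_1|y|^{\frac1\sigma}\left(\log|y|\right)^{-1}\right)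 & \text{in (Case 1)},\\[1mm] \exp\left(-C_2|y|^{\frac1\sigma}\left(\log|y|\right)^{\frac1\sigma-1}\right) & \text{in (Case 2)}.\end{cases}$$
   Context: Here $k=\mathbb{Q}(\sqrt{-3})$, $\zeta_3=\exp(2\pi i/3)$, and $\mathfrak{O}_k=\mathbb{Z}[\zeta_3]$ is the ring of integers of $k$; the products run over the prime ideals $\mathfrak{p}$ of $\mathfrak{O}_k$ not dividing $\langle 3\rangle$, $\mathrm{N}(\mathfrak{p})$ is the norm of $\mathfrak{p}$, and the logarithms of complex numbers are principal. *)

theory Defs
  imports "HOL-Analysis.Analysis" "HOL-Algebra.QuotRing" "HOL-Algebra.Ideal_Product"
begin

definition \<zeta>\<^sub>3 :: complex where
  "\<zeta>\<^sub>3 = exp (2 * of_real pi * \<i> / 3)"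

text \<open>The ring of integers \<open>\<int>[\<zeta>\<^sub>3]\<close> of \<open>\<rat>(\<surd>-3)\<close>. Two coefficients suffice because
  \<open>\<zeta>\<^sub>3\<^sup>2 = -1 - \<zeta>\<^sub>3\<close>.\<close>

definition O\<^sub>k :: "complex ring" where
  "O\<^sub>k = \<lparr>carrier = {of_int a + of_int b * \<zeta>\<^sub>3 | a b. True},
         mult = (*), one = 1, zero = 0, add = (+)\<rparr>"

definition ideal_dvd :: "complex set \<Rightarrow> complex set \<Rightarrow> bool" where
  "ideal_dvd I J \<longleftrightarrow> (\<exists>K. ideal K O\<^sub>k \<and> J = ideal_prod O\<^sub>k I K)"

text \<open>The zero ideal satisfies \<^const>\<open>primeideal\<close> and does not divide \<open>\<langle>3\<rangle>\<close>, so it has to be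
  excluded explicitly.\<close>

definition primes_not_dvd_3 :: "complex set set" where
  "primes_not_dvd_3 =
     {P. primeideal P O\<^sub>k \<and> P \<noteq> {0} \<and> \<not> ideal_dvd P (PIdl\<^bsub>O\<^sub>k\<^esub> 3)}"

definition ideal_norm :: "complex set \<Rightarrow> nat" where
  "ideal_norm I = card (carrier (O\<^sub>k Quot I))"

text \<open>Unordered infinite product: the limit of the finite partial products along the net of
  finite subsets, as for \<^const>\<open>infsum\<close>. There is no default value: \<^const>\<open>Lim\<close> is unspecified
  where the product does not converge.\<close>

definition infprod :: "('a \<Rightarrow> complex) \<Rightarrow> 'a set \<Rightarrow> complex" where
  "infprod f A = Lim (finite_subsets_at_top A) (\<lambda>F. \<Prod>x\<in>F. f x)"

definition M_case1 :: "complex \<Rightarrow> real \<Rightarrow> real \<Rightarrow> complex" where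
  "M_case1 s y1 y2 =
    (let y = Complex y1 y2 in
      exp (- \<i> * of_real (Re (cnj y * Ln (1 - 3 powr (- s))))) *
      infprod (\<lambda>P. let N = of_nat (ideal_norm P) :: complex in
          1 / (N + 1) + 1 / 3 * (N / (N + 1)) *
            (\<Sum>j = 0..2::nat. exp (- \<i> * of_real (Re (cnj y * Ln (1 - \<zeta>\<^sub>3 ^ j / N powr s))))))
        primes_not_dvd_3)"

definition M_case2 :: "complex \<Rightarrow> real \<Rightarrow> real \<Rightarrow> complex" where
  "M_case2 s y1 y2 =
    (let y = Complex y1 y2 in
      exp (- \<i> * of_real (Re (cnj y * Ln 3 / (3 powr s - 1)))) *
      infprod (\<lambda>P. let N = of_nat (ideal_norm P) :: complex in
          1 / (N + 1) + 1 / 3 * (N / (N + 1)) *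
            (\<Sum>j = 0..2::nat. exp (- \<i> * of_real
               (Re (cnj y * \<zeta>\<^sub>3 ^ j * Ln N / (N powr s - \<zeta>\<^sub>3 ^ j))))))
        primes_not_dvd_3)"

lemma zeta3_square: "\<zeta>\<^sub>3 * \<zeta>\<^sub>3 = - 1 - \<zeta>\<^sub>3"
proof -
  have z: "\<zeta>\<^sub>3 = Complex (- 1 / 2) (sqrt 3 / 2)"
    by (simp add: \<zeta>\<^sub>3_def complex_eq_iff Re_exp Im_exp cos_120 sin_120)
  show ?thesis
    by (simp add: z complex_eq_iff)
qed

lemma O\<^sub>k_simps [simp]:
  "x \<oplus>\<^bsub>O\<^sub>k\<^esub> y = x + y" "x \<otimes>\<^bsub>O\<^sub>k\<^esub> y = x * y" "\<one>\<^bsub>O\<^sub>k\<^esub> = 1" "\<zero>\<^bsub>O\<^sub>k\<^esub> = 0"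
  by (simp_all add: O\<^sub>k_def)

lemma mem_O\<^sub>k_iff: "x \<in> carrier O\<^sub>k \<longleftrightarrow> (\<exists>a b :: int. x = of_int a + of_int b * \<zeta>\<^sub>3)"
  by (simp add: O\<^sub>k_def)

lemma O\<^sub>k_cring: "cring O\<^sub>k"
proof (rule cringI)
  show "abelian_group O\<^sub>k"
  proof (rule abelian_groupI)
    fix x y assume "x \<in> carrier O\<^sub>k" "y \<in> carrier O\<^sub>k"
    then obtain a b c d :: int where
      "x = of_int a + of_int b * \<zeta>\<^sub>3" "y = of_int c + of_int d * \<zeta>\<^sub>3"
      by (auto simp: mem_O\<^sub>k_iff)
    hence "x + y = of_int (a + c) + of_int (b + d) * \<zeta>\<^sub>3"
      by (simp add: algebra_simps)
    thus "x \<oplus>\<^bsub>O\<^sub>k\<^esub> y \<in> carrier O\<^sub>k"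
      unfolding mem_O\<^sub>k_iff O\<^sub>k_simps by blast
  next
    have "0 = of_int 0 + of_int 0 * \<zeta>\<^sub>3" by simp
    thus "\<zero>\<^bsub>O\<^sub>k\<^esub> \<in> carrier O\<^sub>k"
      unfolding mem_O\<^sub>k_iff O\<^sub>k_simps by blast
  next
    fix x assume "x \<in> carrier O\<^sub>k"
    then obtain a b :: int where "x = of_int a + of_int b * \<zeta>\<^sub>3"
      by (auto simp: mem_O\<^sub>k_iff)
    hence "(of_int (- a) + of_int (- b) * \<zeta>\<^sub>3) + x = 0" by simp
    moreover have "of_int (- a) + of_int (- b) * \<zeta>\<^sub>3 \<in> carrier O\<^sub>k"
      unfolding mem_O\<^sub>k_iff O\<^sub>k_simps by blast
    ultimately show "\<exists>y\<in>carrier O\<^sub>k. y \<oplus>\<^bsub>O\<^sub>k\<^esub> x = \<zero>\<^bsub>O\<^sub>k\<^esub>"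
      by (intro bexI) (auto simp: O\<^sub>k_def)
  qed (auto simp: algebra_simps)
next
  show "comm_monoid O\<^sub>k"
  proof (rule comm_monoidI)
    fix x y assume "x \<in> carrier O\<^sub>k" "y \<in> carrier O\<^sub>k"
    then obtain a b c d :: int where
      xy: "x = of_int a + of_int b * \<zeta>\<^sub>3" "y = of_int c + of_int d * \<zeta>\<^sub>3"
      by (auto simp: mem_O\<^sub>k_iff)
    have "x * y = of_int a * of_int c + of_int (a * d + b * c) * \<zeta>\<^sub>3
                    + of_int b * of_int d * (\<zeta>\<^sub>3 * \<zeta>\<^sub>3)"
      by (simp add: xy algebra_simps)
    also have "\<dots> = of_int (a * c - b * d) + of_int (a * d + b * c - b * d) * \<zeta>\<^sub>3"
      by (simp add: zeta3_square algebra_simps)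
    finally show "x \<otimes>\<^bsub>O\<^sub>k\<^esub> y \<in> carrier O\<^sub>k"
      unfolding mem_O\<^sub>k_iff O\<^sub>k_simps by blast
  next
    have "1 = of_int 1 + of_int 0 * \<zeta>\<^sub>3" by simp
    thus "\<one>\<^bsub>O\<^sub>k\<^esub> \<in> carrier O\<^sub>k"
      unfolding mem_O\<^sub>k_iff O\<^sub>k_simps by blast
  qed (auto simp: algebra_simps)
qed (auto simp: algebra_simps)

end

theory Submission
  imports Defs "HOL-Number_Theory.Number_Theory"
begin

text \<open>Every factor of the product is a convex combination of numbers of modulus 1, so its modulus is
  at most 1 and \<open>\<bar>M\<^sub>s\<bar>\<close> is at most the product of the moduli over any finite set of prime
  ideals. For a prime \<open>p \<equiv> 1\<close> mod 3 there is a prime ideal of norm \<open>p\<close>, and its factor has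
  modulus at most \<open>1 - c\<close> as soon as \<open>\<bar>y\<bar> p\<^sup>-\<^sup>\<sigma>\<close> (Case 1) or \<open>\<bar>y\<bar> p\<^sup>-\<^sup>\<sigma> log p\<close> (Case 2) lies in a
  fixed compact subset of the positive reals below 1. This holds for all \<open>p\<close> between
  \<open>X\<close> and \<open>B X\<close>, where \<open>X\<^sup>\<sigma>\<close> is of order \<open>\<bar>y\<bar>\<close> or \<open>\<bar>y\<bar> log \<bar>y\<bar>\<close>; by Mertens' theorem
  for primes 1 mod 3 there are at least \<open>X / log (B X)\<close> of them when \<open>B\<close> is large.

  The product converges because the factors are \<open>1 + O(N\<^sup>-\<^sup>a)\<close> for some \<open>a > 1\<close> and at most three
  prime ideals lie over each rational prime.\<close>

subsection \<open>Primes congruent to 1 mod 3\<close>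

text \<open>Only ideals of prime norm are frequent enough: an inert prime has norm p^2, and there
  are far too few of those up to X to reach the claimed exponent. With X^\<sigma> of order |y|,
  respectively |y| log |y|, a count of X / log X yields the two exponents of the theorem. A lower
  bound of this order on a window of bounded ratio suffices, so Mertens' theorem does; its input on
  the character is that the partial sums of L(1, \<chi>) stay above 1/2. The condition \<sigma> >
  1/2 enters through convergence. For \<sigma> \<le> 1 the numbers N^-\<sigma> are not summable over
  the ideals, but the cube roots of unity sum to zero, which leaves N^(-2\<sigma>) up to logarithms.
  Since \<open>infprod\<close> is a bare \<open>Lim\<close>, convergence has to precede every bound
  on its value. The imaginary part of s merely rotates N^-s, and the estimate of a local factor sees
  only its modulus. With B absolute, the constants and even the threshold on |y| depend on \<sigma>
  alone.\<close>

definition chi3 :: "nat \<Rightarrow> real" where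
  "chi3 n = (if n mod 3 = 1 then 1 else if n mod 3 = 2 then - 1 else 0)"

lemma chi3_mult: "chi3 (m * n) = chi3 m * chi3 n"
proof -
  have "m mod 3 < 3" "n mod 3 < 3" by simp_all
  then have "m mod 3 \<in> {0, 1, 2}" "n mod 3 \<in> {0, 1, 2}" by auto
  moreover have "m * n mod 3 = (m mod 3) * (n mod 3) mod 3" by (simp add: mod_mult_eq)
  ultimately show ?thesis by (auto simp: chi3_def)
qed

lemma abs_chi3_le_1: "\<bar>chi3 n\<bar> \<le> 1"
  by (simp add: chi3_def)

text \<open>The nonzero terms alternate in sign, so this is Leibniz's criterion. The sign belongs to
  the claim because the induction needs it: peeling off the first term moves \<open>a\<close> to the
  next residue class, and for \<open>a mod 3 = 1\<close> the tail must be nonpositive for the sum to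
  stay below \<open>f a\<close>.\<close>

lemma sum_chi3_antimono_aux:
  fixes f :: "nat \<Rightarrow> real"
  assumes "\<And>n. n \<ge> a \<Longrightarrow> 0 \<le> f n" "\<And>n. n \<ge> a \<Longrightarrow> f (Suc n) \<le> f n"
  shows "(a mod 3 = 2 \<longrightarrow> (\<Sum>n=a..<a+k. chi3 n * f n) \<in> {- f a..0}) \<and>
    (a mod 3 \<noteq> 2 \<longrightarrow> (\<Sum>n=a..<a+k. chi3 n * f n) \<in> {0..f a})"
  using assms
proof (induction k arbitrary: a)
  case 0
  then show ?case by auto
next
  case (Suc k)
  have split: "(\<Sum>n=a..<a+Suc k. chi3 n * f n) = chi3 a * f a + (\<Sum>n=Suc a..<Suc a+k. chi3 n * f n)"
    by (subst sum.atLeast_Suc_lessThan) auto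
  have IH: "(Suc a mod 3 = 2 \<longrightarrow> (\<Sum>n=Suc a..<Suc a+k. chi3 n * f n) \<in> {- f (Suc a)..0}) \<and>
    (Suc a mod 3 \<noteq> 2 \<longrightarrow> (\<Sum>n=Suc a..<Suc a+k. chi3 n * f n) \<in> {0..f (Suc a)})"
    using Suc.prems by (intro Suc.IH) auto
  have f: "0 \<le> f a" "0 \<le> f (Suc a)" "f (Suc a) \<le> f a" using Suc.prems by auto
  have "a mod 3 = 0 \<and> Suc a mod 3 = 1 \<or> a mod 3 = 1 \<and> Suc a mod 3 = 2
      \<or> a mod 3 = 2 \<and> Suc a mod 3 = 0"
    by presburger
  then show ?case
  proof (elim disjE conjE)
    assume "a mod 3 = 0" "Suc a mod 3 = 1"
    then show ?thesis using f IH unfolding split by (simp add: chi3_def)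
  next
    assume "a mod 3 = 1" "Suc a mod 3 = 2"
    then show ?thesis using f IH unfolding split by (simp add: chi3_def)
  next
    assume "a mod 3 = 2" "Suc a mod 3 = 0"
    then show ?thesis using f IH unfolding split by (simp add: chi3_def)
  qed
qed

lemma sum_chi3_antimono:
  fixes f :: "nat \<Rightarrow> real"
  assumes "\<And>n. n \<ge> a \<Longrightarrow> 0 \<le> f n" "\<And>n. n \<ge> a \<Longrightarrow> f (Suc n) \<le> f n" "a \<le> b"
  shows "\<bar>\<Sum>n=a..<b. chi3 n * f n\<bar> \<le> f a"
proof -
  obtain k where k: "b = a + k" using assms(3) le_Suc_ex by blast
  have "0 \<le> f a" using assms by auto
  then show ?thesis
    using sum_chi3_antimono_aux[of a f k] assms(1,2) unfolding k
    by (cases "a mod 3 = 2") (auto simp: abs_le_iff)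
qed

text \<open>The first term is 1 and the alternating tail from 2 on is at most 1/2. This uniform
  bound takes the place of the nonvanishing of L(1, \<chi>).\<close>

lemma sum_chi3_divide_ge:
  assumes "x \<ge> 1"
  shows "(\<Sum>n=1..x. chi3 n / n) \<ge> 1 / 2"
proof -
  let ?f = "\<lambda>n::nat. 1 / real n"
  have S: "(\<Sum>n=1..x. chi3 n / n) = (\<Sum>n=1..<Suc x. chi3 n * ?f n)"
    by (simp add: atLeastLessThanSuc_atLeastAtMost)
  also have "\<dots> = 1 + (\<Sum>n=2..<Suc x. chi3 n * ?f n)"
    using assms by (subst sum.atLeast_Suc_lessThan) (auto simp: chi3_def numeral_2_eq_2)
  also have "\<bar>\<Sum>n=2..<Suc x. chi3 n * ?f n\<bar> \<le> ?f 2"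
    by (rule sum_chi3_antimono) (use assms in \<open>auto simp: field_simps\<close>)
  then have "1 + (\<Sum>n=2..<Suc x. chi3 n * ?f n) \<ge> 1 / 2" by simp
  finally show ?thesis .
qed

lemma sum_chi3_divide_diff:
  assumes "y \<le> x"
  shows "\<bar>(\<Sum>n=1..x. chi3 n / n) - (\<Sum>n=1..y. chi3 n / n)\<bar> \<le> 1 / (y + 1)"
proof -
  let ?f = "\<lambda>n::nat. 1 / real n"
  have "(\<Sum>n=1..x. chi3 n / n) - (\<Sum>n=1..y. chi3 n / n)
      = (\<Sum>n=1..<Suc x. chi3 n / n) - (\<Sum>n=1..<Suc y. chi3 n / n)"
    by (simp add: atLeastLessThanSuc_atLeastAtMost)
  also have "\<dots> = (\<Sum>n=Suc y..<Suc x. chi3 n * ?f n)"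
    using assms by (subst sum.atLeastLessThan_concat[of 1 "Suc y" "Suc x", symmetric]) auto
  also have "\<bar>\<dots>\<bar> \<le> ?f (Suc y)"
    by (rule sum_chi3_antimono) (use assms in \<open>auto simp: field_simps\<close>)
  finally show ?thesis by (simp add: add.commute)
qed

lemma mult_ln_Suc_diff_le_1: "real n * (ln (real n + 1) - ln (real n)) \<le> 1"
proof (cases "n = 0")
  case False
  have "ln (real n + 1) - ln (real n) = ln (1 + 1 / real n)"
    using False by (subst ln_divide_pos[symmetric]) (auto simp: add_divide_distrib)
  also have "\<dots> \<le> 1 / real n" using False by (intro ln_add_one_self_le_self) auto
  finally show ?thesis using False by (simp add: field_simps)
qed auto

text \<open>The function ln n / n decreases only from 3 on, its maximum being at e, so the terms
  below 3 are evaluated by hand and the alternation bound is applied to the rest.\<close>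

lemma sum_chi3_ln_divide: "\<bar>\<Sum>n=1..x. chi3 n * (ln n / n)\<bar> \<le> 1"
proof (cases "x < 3")
  case True
  then have "x = 0 \<or> x = 1 \<or> x = 2" by auto
  moreover have "{1..2::nat} = {1,2}" by auto
  ultimately show ?thesis using ln_2_less_1 by (auto simp: chi3_def)
next
  case False
  let ?f = "\<lambda>n::nat. ln (real n) / real n"
  have ln3: "1 \<le> ln (3::real)" using exp_le by (subst ln_ge_iff) auto
  have dec: "?f (Suc n) \<le> ?f n" if "n \<ge> 3" for n
  proof -
    have "ln (real n) \<ge> 1" using that ln3 ln_mono[of 3 "real n"] by linarith
    then have "real n * (ln (real n + 1) - ln (real n)) \<le> ln n"
      using mult_ln_Suc_diff_le_1[of n] by linarith
    then show ?thesis using that by (simp add: field_simps)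
  qed
  have "(\<Sum>n=1..x. chi3 n * ?f n) = (\<Sum>n=1..<Suc x. chi3 n * ?f n)"
    by (simp add: atLeastLessThanSuc_atLeastAtMost)
  also have "\<dots> = (\<Sum>n=1..<3. chi3 n * ?f n) + (\<Sum>n=3..<Suc x. chi3 n * ?f n)"
    using False by (subst sum.atLeastLessThan_concat) auto
  also have "(\<Sum>n=1..<3::nat. chi3 n * ?f n) = - ln 2 / 2"
    by (simp add: eval_nat_numeral) (simp add: chi3_def)
  finally have eq: "(\<Sum>n=1..x. chi3 n * ?f n) = - ln 2 / 2 + (\<Sum>n=3..<Suc x. chi3 n * ?f n)" .
  have "\<bar>\<Sum>n=3..<Suc x. chi3 n * ?f n\<bar> \<le> ?f 3"
    by (rule sum_chi3_antimono) (use False dec in auto)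
  \<comment> \<open>The two instances give ln 3 \<le> ln 2 + 1/2 < 3/2.\<close>
  also have "?f 3 \<le> 1 / 2"
    using mult_ln_Suc_diff_le_1[of 1] mult_ln_Suc_diff_le_1[of 2] ln_2_less_1 by simp
  finally show ?thesis using ln_2_less_1 ln_ge_zero[of 2] unfolding eq by linarith
qed

section \<open>Chebyshev's bound and Mertens' first theorem\<close>

lemma real_of_nat_div_le: "real (m div n) \<le> real m / real n"
  using of_int_floor_le[of "real m / real n"] by (simp add: floor_divide_of_nat_eq)

lemma real_of_nat_div_ge: "real m / real n \<le> real (m div n) + 1"
  using real_of_int_floor_add_one_ge[of "real m / real n"] by (simp add: floor_divide_of_nat_eq)

text \<open>Both sides run over the pairs with \<open>d * m \<le> x\<close>; the left one groups
  them by their product, the right one by \<open>d\<close>.\<close>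

lemma sum_divisors_swap:
  fixes f :: "nat \<Rightarrow> nat \<Rightarrow> real"
  shows "(\<Sum>n=1..x. \<Sum>d | d dvd n. f d (n div d)) = (\<Sum>d=1..x. \<Sum>m=1..x div d. f d m)"
proof -
  have "(\<Sum>n=1..x. \<Sum>d | d dvd n. f d (n div d))
      = (\<Sum>(n,d)\<in>Sigma {1..x} (\<lambda>n. {d. d dvd n}). f d (n div d))"
    by (rule sum.Sigma) auto
  also have "\<dots> = (\<Sum>(d,m)\<in>Sigma {1..x} (\<lambda>d. {1..x div d}). f d m)"
  proof (rule sum.reindex_bij_witness[of _ "\<lambda>(d,m). (d * m, d)" "\<lambda>(n,d). (d, n div d)"], goal_cases)
    case (2 a)
    then obtain n d where "a = (n, d)" "1 \<le> n" "n \<le> x" "d dvd n" by auto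
    moreover from this have "d \<le> n" "0 < d" by (auto intro: dvd_imp_le dvd_pos_nat)
    ultimately show ?case by (auto simp: div_le_mono Suc_le_eq div_greater_zero_iff)
  next
    case (4 b)
    then obtain d m where "b = (d, m)" "1 \<le> d" "1 \<le> m" "m \<le> x div d" by auto
    moreover from this have "d * m \<le> x"
      by (metis div_times_less_eq_dividend le_trans mult.commute mult_le_mono2)
    ultimately show ?case by (auto simp: Suc_le_eq)
  qed (auto simp: dvd_div_mult_self)
  also have "\<dots> = (\<Sum>d=1..x. \<Sum>m=1..x div d. f d m)"
    by (rule sum.Sigma[symmetric]) auto
  finally show ?thesis .
qed

text \<open>The logarithm is the divisor sum of \<open>mangoldt\<close>; twisting by a completely
  multiplicative \<open>g\<close> preserves this. Taking 1 for \<open>g\<close> gives Legendre's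
  formula for the factorial, \<open>chi3 n / n\<close> the sum behind Mertens' theorem for the
  character.\<close>

lemma sum_mult_ln_eq:
  fixes g :: "nat \<Rightarrow> real"
  assumes "\<And>m n. g (m * n) = g m * g n"
  shows "(\<Sum>n=1..x. g n * ln n) = (\<Sum>d=1..x. g d * mangoldt d * (\<Sum>m=1..x div d. g m))"
proof -
  have "(\<Sum>n=1..x. g n * ln n) = (\<Sum>n=1..x. \<Sum>d | d dvd n. g d * mangoldt d * g (n div d))"
  proof (intro sum.cong refl)
    fix n assume "n \<in> {1..x}"
    then have "g n * ln n = g n * (\<Sum>d | d dvd n. mangoldt d)" by (subst mangoldt_sum) auto
    also have "\<dots> = (\<Sum>d | d dvd n. g d * mangoldt d * g (n div d))"
      unfolding sum_distrib_left
    proof (intro sum.cong refl)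
      fix d assume "d \<in> {d. d dvd n}"
      then have "g n = g d * g (n div d)" by (metis assms dvd_mult_div_cancel mem_Collect_eq)
      then show "g n * mangoldt d = g d * mangoldt d * g (n div d)" by simp
    qed
    finally show "g n * ln n = (\<Sum>d | d dvd n. g d * mangoldt d * g (n div d))" .
  qed
  also have "\<dots> = (\<Sum>d=1..x. \<Sum>m=1..x div d. g d * mangoldt d * g m)"
    by (rule sum_divisors_swap)
  finally show ?thesis by (simp add: sum_distrib_left)
qed

lemma ln_fact_eq_sum_mangoldt: "ln (fact x) = (\<Sum>d=1..x. mangoldt d * real (x div d))"
proof -
  have "ln (fact x :: real) = (\<Sum>n=1..x. ln n)"
    unfolding fact_prod of_nat_prod by (subst ln_prod) auto
  then show ?thesis using sum_mult_ln_eq[of "\<lambda>_. 1" x] by simp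
qed

lemma ln_fact_bounds: "x * ln x - x \<le> ln (fact x)" "ln (fact x) \<le> x * ln x"
proof -
  show "x * ln x - x \<le> ln (fact x)"
  proof (induction x)
    case (Suc n)
    have "ln (fact (Suc n) :: real) = ln (real n + 1) + ln (fact n)"
      by (simp add: ln_mult add.commute)
    then show ?case using Suc mult_ln_Suc_diff_le_1[of n] by (simp add: algebra_simps)
  qed auto
  show "ln (fact x) \<le> x * ln x"
  proof (cases "x = 0")
    case False
    have "ln (fact x :: real) \<le> ln (real x ^ x)"
      using fact_le_power[of x, where 'a = real] False by (subst ln_le_cancel_iff) auto
    then show ?thesis using False by (simp add: ln_realpow)
  qed auto
qed

definition cheb_psi :: "nat \<Rightarrow> real" where
  "cheb_psi n = (\<Sum>d=1..n. mangoldt d)"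

text \<open>Chebyshev's argument: \<open>2 * n div d\<close> minus twice \<open>n div d\<close> is
  never negative and is at least 1 for n < d \<le> 2n, so the difference of the two values is at
  most the logarithm of the central binomial coefficient, which is below 4^n.\<close>

lemma cheb_psi_double: "cheb_psi (2 * n) \<le> cheb_psi n + 2 * n * ln 2"
proof -
  have "cheb_psi (2 * n) - cheb_psi n = (\<Sum>d=1..2*n. if d > n then mangoldt d else 0)"
  proof -
    have "cheb_psi (2 * n) = cheb_psi n + (\<Sum>d=n+1..2*n. mangoldt d)"
      unfolding cheb_psi_def using sum.ub_add_nat[of 1 n mangoldt n] by (simp add: mult_2)
    also have "(\<Sum>d=n+1..2*n. mangoldt d :: real) = (\<Sum>d=1..2*n. if d > n then mangoldt d else 0)"
      by (rule sum.mono_neutral_cong_left) auto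
    finally show ?thesis by simp
  qed
  also have "\<dots> \<le> (\<Sum>d=1..2*n. mangoldt d * (real (2 * n div d) - 2 * real (n div d)))"
  proof (intro sum_mono)
    fix d assume d: "d \<in> {1..2*n}"
    show "(if d > n then mangoldt d else 0) \<le> mangoldt d * (real (2 * n div d) - 2 * real (n div d))"
    proof (cases "d > n")
      case True
      then have "n div d = 0" "2 * n div d \<ge> 1"
        using d by (auto simp: Suc_le_eq div_greater_zero_iff)
      then show ?thesis using True mangoldt_nonneg[of d] by (simp add: mult_le_cancel_left1)
    next
      case False
      have "2 * (n div d) \<le> 2 * n div d"
        using d by (simp add: less_eq_div_iff_mult_less_eq)
      then have "real (2 * n div d) - 2 * real (n div d) \<ge> 0"
        by (metis diff_ge_0_iff_ge of_nat_le_iff of_nat_mult of_nat_numeral)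
      then show ?thesis using False mangoldt_nonneg[of d] by simp
    qed
  qed
  also have "\<dots> = ln (fact (2 * n)) - 2 * ln (fact n)"
  proof -
    have "(\<Sum>d=1..n. mangoldt d * real (n div d)) = (\<Sum>d=1..2*n. mangoldt d * real (n div d))"
      by (rule sum.mono_neutral_left) (auto simp: div_eq_0_iff)
    then show ?thesis
      by (simp add: ln_fact_eq_sum_mangoldt sum_subtractf[symmetric] sum_distrib_left algebra_simps)
  qed
  also have "\<dots> \<le> 2 * n * ln 2"
  proof -
    have "fact (2 * n) = fact n * fact n * real (2 * n choose n)"
      using binomial_fact_lemma[of n "2 * n"]
      by (metis le_add1 mult_2 add_diff_cancel_left' of_nat_fact of_nat_mult)
    moreover have "0 < (2 * n choose n)" by simp
    ultimately have "ln (fact (2 * n)) = 2 * ln (fact n) + ln (real (2 * n choose n))"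
      by (simp add: ln_mult)
    moreover have "ln (real (2 * n choose n)) \<le> ln (2 ^ (2 * n))"
      using binomial_le_pow2[of "2 * n" n] \<open>0 < (2 * n choose n)\<close>
      by (metis ln_mono of_nat_0_less_iff of_nat_le_iff of_nat_numeral of_nat_power)
    ultimately show ?thesis by (simp add: ln_realpow)
  qed
  finally show ?thesis by simp
qed

lemma cheb_psi_le: "cheb_psi n \<le> 4 * n"
proof (induction n rule: less_induct)
  case (less n)
  show ?case
  proof (cases "n = 0")
    case True
    then show ?thesis by (simp add: cheb_psi_def)
  next
    case False
    define m where "m = n div 2"
    have m: "m < n" using False by (simp add: m_def)
    \<comment> \<open>Doubling turns 4m into at most 6m, although 8m is allowed. The remaining 2m
      pays for the extra term at odd \<open>n\<close>, which is at most ln n \<le> n - 1 =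
      2m.\<close>
    have "real m * ln 2 \<le> m" using ln_2_less_1 by (simp add: mult_left_le)
    then have *: "cheb_psi (2 * m) \<le> 6 * m"
      using cheb_psi_double[of m] less.IH[OF m] by simp
    have "n = 2 * m \<or> n = Suc (2 * m)" unfolding m_def by presburger
    then show ?thesis
    proof
      assume n: "n = Suc (2 * m)"
      have "cheb_psi n = cheb_psi (2 * m) + mangoldt n" unfolding n cheb_psi_def by simp
      moreover have "mangoldt n \<le> ln n" using False by (intro mangoldt_le) auto
      moreover have "ln n \<le> real n - 1" using False ln_le_minus_one by simp
      ultimately show ?thesis using * n by simp
    qed (use * in auto)
  qed
qed

text \<open>Replacing \<open>x div d\<close> by x / d in Legendre's formula costs at most
  \<open>cheb_psi x\<close>, hence the 4; the 1 comes from the lower bound for the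
  factorial.\<close>

lemma mertens_bounds:
  assumes "x \<ge> 1"
  shows "ln x - 1 \<le> (\<Sum>d=1..x. mangoldt d / d)" "(\<Sum>d=1..x. mangoldt d / d) \<le> ln x + 4"
proof -
  have "ln (fact x) \<le> (\<Sum>d=1..x. mangoldt d * (real x / d))"
    unfolding ln_fact_eq_sum_mangoldt
    by (intro sum_mono mult_left_mono mangoldt_nonneg) (simp_all add: real_of_nat_div_le)
  then have "x * (ln x - 1) \<le> x * (\<Sum>d=1..x. mangoldt d / d)"
    using ln_fact_bounds(1)[of x] by (simp add: sum_distrib_left algebra_simps)
  then show "ln x - 1 \<le> (\<Sum>d=1..x. mangoldt d / d)" using assms by simp
  have "(\<Sum>d=1..x. mangoldt d * (real x / d)) \<le> (\<Sum>d=1..x. mangoldt d * real (x div d) + mangoldt d)"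
  proof (intro sum_mono)
    fix d assume "d \<in> {1..x}"
    have "real x / d \<le> real (x div d) + 1" using real_of_nat_div_ge[of x d] by simp
    then have "mangoldt d * (real x / d) \<le> mangoldt d * (real (x div d) + 1)"
      by (intro mult_left_mono mangoldt_nonneg)
    then show "mangoldt d * (real x / d) \<le> mangoldt d * real (x div d) + mangoldt d"
      by (simp add: algebra_simps)
  qed
  also have "\<dots> = ln (fact x) + cheb_psi x"
    by (simp add: sum.distrib cheb_psi_def ln_fact_eq_sum_mangoldt)
  also have "\<dots> \<le> x * (ln x + 4)"
    using ln_fact_bounds(2)[of x] cheb_psi_le[of x] by (simp add: algebra_simps)
  finally have "x * (\<Sum>d=1..x. mangoldt d / d) \<le> x * (ln x + 4)"
    by (simp add: sum_distrib_left algebra_simps)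
  then show "(\<Sum>d=1..x. mangoldt d / d) \<le> ln x + 4" using assms by simp
qed

text \<open>The partial sum \<open>A x\<close> of \<open>L(1, \<chi>)\<close> stands in for its limit: it is at least \<open>1/2\<close>, and replacing
  \<open>A (x div d)\<close> by it in the convolution identity for \<open>\<chi> \<cdot> ln\<close> costs only \<open>cheb_psi x / x\<close>.\<close>

lemma mertens_chi3:
  assumes "x \<ge> 1"
  shows "\<bar>\<Sum>d=1..x. chi3 d * mangoldt d / d\<bar> \<le> 10"
proof -
  define A where "A y = (\<Sum>n=1..y. chi3 n / real n)" for y :: nat
  define S where "S = (\<Sum>d=1..x. chi3 d * mangoldt d / d)"
  have A: "A x \<ge> 1 / 2" unfolding A_def by (rule sum_chi3_divide_ge[OF assms])
  have "(\<Sum>n=1..x. chi3 n / n * ln n) = (\<Sum>d=1..x. chi3 d / d * mangoldt d * A (x div d))"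
    unfolding A_def by (rule sum_mult_ln_eq) (auto simp: chi3_mult)
  then have eq: "A x * S = (\<Sum>n=1..x. chi3 n * (ln n / n))
      + (\<Sum>d=1..x. chi3 d / d * mangoldt d * (A x - A (x div d)))"
    by (simp add: S_def right_diff_distrib diff_divide_distrib sum_subtractf sum_distrib_left mult.commute mult.left_commute)
  have "\<bar>\<Sum>d=1..x. chi3 d / d * mangoldt d * (A x - A (x div d))\<bar>
      \<le> (\<Sum>d=1..x. mangoldt d / x)"
  proof (rule order.trans[OF sum_abs], intro sum_mono)
    fix d assume d: "d \<in> {1..x}"
    have "\<bar>A x - A (x div d)\<bar> \<le> 1 / (real (x div d) + 1)"
      unfolding A_def using sum_chi3_divide_diff[of "x div d" x] by (simp add: add.commute)
    also have "\<dots> \<le> d / x"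
      using real_of_nat_div_ge[of x d] d by (simp add: field_simps)
    finally have "\<bar>chi3 d / d * mangoldt d\<bar> * \<bar>A x - A (x div d)\<bar> \<le> (mangoldt d / d) * (d / x)"
      using abs_chi3_le_1[of d] mangoldt_nonneg[of d] d
      by (intro mult_mono) (auto simp: abs_mult divide_simps mult_left_le_one_le)
    then show "\<bar>chi3 d / d * mangoldt d * (A x - A (x div d))\<bar> \<le> mangoldt d / x"
      using d by (simp add: abs_mult)
  qed
  also have "\<dots> = cheb_psi x / x" by (simp add: cheb_psi_def sum_divide_distrib)
  also have "\<dots> \<le> 4" using cheb_psi_le[of x] assms by (simp add: field_simps)
  finally have "\<bar>A x * S\<bar> \<le> 5" using eq sum_chi3_ln_divide[of x] by linarith
  moreover have "\<bar>A x * S\<bar> \<ge> 1 / 2 * \<bar>S\<bar>"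
    unfolding abs_mult using A by (intro mult_right_mono) auto
  ultimately show ?thesis unfolding S_def by linarith
qed


section \<open>From prime powers to primes, and from weighted sums to counts\<close>

lemma sum_power_from_2_le:
  fixes r :: real
  assumes "0 \<le> r" "r \<le> 1 / 2"
  shows "(\<Sum>k=2..n. r ^ k) \<le> 2 * r\<^sup>2"
proof -
  \<comment> \<open>The subtracted term makes the induction close: it halves when the next power is
    added, and 2r \<le> 1 restores it.\<close>
  have "(\<Sum>k=2..<2+m. r ^ k) \<le> 2 * r\<^sup>2 - 2 * r ^ (2 + m)" for m
  proof (induction m)
    case (Suc m)
    have "2 * (r * r ^ (2 + m)) \<le> r ^ (2 + m)"
      using assms mult_right_mono[of "2 * r" 1 "r ^ (2 + m)"] by simp
    then show ?case using Suc by simp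
  qed simp
  from this[of "Suc n - 2"] have "(\<Sum>k=2..<2 + (Suc n - 2). r ^ k) \<le> 2 * r\<^sup>2"
    using assms by (smt (verit) zero_le_power)
  also have "{2..<2 + (Suc n - 2)} = {2..n}" by auto
  finally show ?thesis .
qed

text \<open>Only powers p^k with k \<ge> 2 contribute. For fixed p the geometric series leaves at
  most 2 ln p / p^2, and ln p \<le> 2 sqrt p makes this summable like p^(-3/2).\<close>

lemma sum_mangoldt_nonprime_bounded:
  "\<exists>C. \<forall>x. (\<Sum>d\<in>{d\<in>{1..x}. \<not> prime d}. mangoldt d / d) \<le> (C::real)"
proof (intro exI allI)
  fix x :: nat
  let ?g = "\<lambda>d::nat. mangoldt d / real d"
  \<comment> \<open>A square of pairs is large enough, since p and k are both at most p^k \<le> x;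
    the surplus terms are nonnegative.\<close>
  define S where "S = Sigma {p\<in>{2..x}. prime p} (\<lambda>_. {2..x})"
  have sm: "summable (\<lambda>p::nat. 4 * real p powr (- 3 / 2))"
    by (intro summable_mult) (simp add: summable_real_powr_iff)
  have "(\<Sum>d\<in>{d\<in>{1..x}. \<not> prime d}. ?g d) = (\<Sum>d\<in>{d\<in>{1..x}. primepow d \<and> \<not> prime d}. ?g d)"
    by (rule sum.mono_neutral_right) (auto simp: mangoldt_def)
  also have "\<dots> \<le> (\<Sum>d\<in>(\<lambda>(p,k). p ^ k) ` S. ?g d)"
  proof (rule sum_mono2)
    show "{d\<in>{1..x}. primepow d \<and> \<not> prime d} \<subseteq> (\<lambda>(p,k). p ^ k) ` S"
    proof
      fix d assume "d \<in> {d\<in>{1..x}. primepow d \<and> \<not> prime d}"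
      then obtain p k where d: "prime p" "k > 0" "d = p ^ k" "d \<le> x" "\<not> prime d"
        by (auto simp: primepow_def)
      then have "k \<noteq> 1" by auto
      then have "k \<ge> 2" using d by simp
      moreover have "p \<ge> 2" using d by (simp add: prime_ge_2_nat)
      moreover have "k < p ^ k" using \<open>p \<ge> 2\<close> by (simp add: power_gt_expt)
      moreover have "p \<le> p ^ k" using \<open>p \<ge> 2\<close> d by (simp add: self_le_power)
      ultimately show "d \<in> (\<lambda>(p,k). p ^ k) ` S"
        using d unfolding S_def by (intro image_eqI[of _ _ "(p, k)"]) auto
    qed
  qed (auto simp: S_def intro!: divide_nonneg_nonneg mangoldt_nonneg)
  also have "\<dots> \<le> (\<Sum>a\<in>S. ?g (case a of (p,k) \<Rightarrow> p ^ k))"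
    using sum_image_le[of S ?g "\<lambda>(p,k). p ^ k"]
    by (auto simp: S_def o_def intro!: divide_nonneg_nonneg mangoldt_nonneg)
  also have "\<dots> = (\<Sum>p\<in>{p\<in>{2..x}. prime p}. \<Sum>k=2..x. ?g (p ^ k))"
    unfolding S_def by (subst sum.Sigma) (auto intro!: sum.cong)
  also have "\<dots> \<le> (\<Sum>p\<in>{p\<in>{2..x}. prime p}. 4 * real p powr (- 3 / 2))"
  proof (intro sum_mono)
    fix p assume p: "p \<in> {p\<in>{2..x}. prime p}"
    then have p2: "real p \<ge> 2" by simp
    have "(\<Sum>k=2..x. ?g (p ^ k)) = ln p * (\<Sum>k=2..x. (1 / real p) ^ k)"
      unfolding sum_distrib_left using p by (intro sum.cong) (auto simp: power_one_over field_simps)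
    also have "\<dots> \<le> ln p * (2 * (1 / real p)\<^sup>2)"
      using p2 by (intro mult_left_mono sum_power_from_2_le) auto
    also have "\<dots> \<le> (2 * real p powr (1 / 2)) * (2 * (1 / real p)\<^sup>2)"
    proof (intro mult_right_mono)
      have "ln p = 2 * ln (real p powr (1 / 2))" using p2 by (simp add: ln_powr)
      also have "ln (real p powr (1 / 2)) \<le> real p powr (1 / 2)"
        using p2 ln_le_minus_one[of "real p powr (1 / 2)"] by simp
      finally show "ln p \<le> 2 * real p powr (1 / 2)" by simp
    qed simp
    also have "(1 / real p)\<^sup>2 = real p powr (- 2)"
      using p2 by (simp add: powr_minus power_one_over inverse_eq_divide)
    also have "(2 * real p powr (1 / 2)) * (2 * real p powr (- 2)) = 4 * real p powr (1 / 2 + - 2)"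
      by (simp only: powr_add)
    also have "(1 / 2 + - 2 :: real) = - 3 / 2" by simp
    finally show "(\<Sum>k=2..x. ?g (p ^ k)) \<le> 4 * real p powr (- 3 / 2)" .
  qed
  also have "\<dots> \<le> (\<Sum>p. 4 * real p powr (- 3 / 2))"
    by (intro sum_le_suminf sm) auto
  finally show "(\<Sum>d\<in>{d\<in>{1..x}. \<not> prime d}. ?g d) \<le> (\<Sum>p. 4 * real p powr (- 3 / 2))" .
qed

text \<open>The weight \<open>1 + chi3 d\<close> is 2, 0 and 1 on the classes 1, 2 and 0. The
  weighted sum of \<open>mangoldt d / d\<close> is ln (y / x) up to a constant by the two Mertens
  estimates; primes 2 mod 3 drop out, and the prime 3 and the proper prime powers cost another
  constant.\<close>

lemma mertens_1_mod_3:
  "\<exists>C::real. \<forall>x\<ge>1. \<forall>y\<ge>x.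
    2 * (\<Sum>p | prime p \<and> p mod 3 = 1 \<and> x < p \<and> p \<le> y. ln (real p) / real p) \<ge> ln (real y) - ln (real x) - C"
proof -
  obtain C :: real where C: "\<And>x. (\<Sum>d\<in>{d\<in>{1..x}. \<not> prime d}. mangoldt d / d) \<le> C"
    using sum_mangoldt_nonprime_bounded by blast
  \<comment> \<open>Here 26 is 1 + 4 from the plain Mertens bounds, 10 + 10 from those for the
    character, and 1 for the prime 3.\<close>
  have "2 * (\<Sum>p | prime p \<and> p mod 3 = 1 \<and> x < p \<and> p \<le> y. ln p / p) \<ge> ln y - ln x - (26 + 2 * C)"
    if xy: "1 \<le> x" "x \<le> y" for x y :: nat
  proof -
    let ?g = "\<lambda>d::nat. mangoldt d / real d"
    let ?h = "\<lambda>d::nat. (1 + chi3 d) * ?g d"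
    let ?W = "{p. prime p \<and> p mod 3 = 1 \<and> x < p \<and> p \<le> y}"
    let ?N = "{d\<in>{1..y}. \<not> prime d}"
    have g0: "?g d \<ge> 0" for d by (intro divide_nonneg_nonneg mangoldt_nonneg) auto
    have h2: "?h d \<le> 2 * ?g d" "?h d \<ge> 0" for d
      using mult_right_mono[OF _ g0, of "1 + chi3 d" 2 d] mult_nonneg_nonneg[OF _ g0, of "1 + chi3 d" d]
        abs_chi3_le_1[of d] by linarith+
    have D: "(\<Sum>d=1..n. ?h d) = (\<Sum>d=1..n. ?g d) + (\<Sum>d=1..n. chi3 d * mangoldt d / d)" for n
      by (simp add: sum.distrib[symmetric] algebra_simps add_divide_distrib)
    have "(\<Sum>d=1..y. ?h d) = (\<Sum>d=1..x. ?h d) + (\<Sum>d\<in>{x<..y}. ?h d)"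
      using xy by (subst sum.union_disjoint[symmetric]) (auto intro!: sum.cong)
    then have "ln y - ln x - 25 \<le> (\<Sum>d\<in>{x<..y}. ?h d)"
      using D[of x] D[of y] mertens_bounds[of x] mertens_bounds[of y]
        mertens_chi3[of x] mertens_chi3[of y] xy by linarith
    also have "\<dots> \<le> (\<Sum>d\<in>(?W \<union> ?N) \<union> {3}. ?h d)"
    proof (rule sum_mono2[THEN order.trans[rotated]])
      have "?h d = 0" if "d \<in> {x<..y} - ((?W \<union> ?N) \<union> {3})" for d
      proof -
        have "prime d" "d mod 3 \<noteq> 1" "d \<noteq> 3" using that by auto
        then have "d mod 3 \<noteq> 0"
          using primes_dvd_imp_eq[of 3 d] by (auto simp: mod_eq_0_iff_dvd)
        then have "d mod 3 = 2" using \<open>d mod 3 \<noteq> 1\<close> by linarith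
        then show ?thesis by (simp add: chi3_def)
      qed
      note h0 = this
      show "(\<Sum>d\<in>{x<..y}. ?h d) \<le> (\<Sum>d\<in>{x<..y} \<inter> (?W \<union> ?N \<union> {3}). ?h d)"
        by (rule eq_refl, rule sum.mono_neutral_right, simp, blast, use h0 in blast)
    qed (use h2 in auto)
    also have "\<dots> \<le> (\<Sum>d\<in>?W. ?h d) + (\<Sum>d\<in>?N. ?h d) + ?h 3"
    proof -
      have U: "(\<Sum>d\<in>A \<union> B. ?h d) \<le> (\<Sum>d\<in>A. ?h d) + (\<Sum>d\<in>B. ?h d)"
        if "finite A" "finite B" for A B
      proof -
        have "0 \<le> (\<Sum>d\<in>A \<inter> B. ?h d)" by (intro sum_nonneg h2)
        then show ?thesis using sum.union_inter[OF that, of ?h] by linarith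
      qed
      show ?thesis using U[of "?W \<union> ?N" "{3}"] U[of ?W ?N] by simp
    qed
    also have "(\<Sum>d\<in>?W. ?h d) = 2 * (\<Sum>p\<in>?W. ln p / p)"
      unfolding sum_distrib_left by (intro sum.cong) (auto simp: chi3_def)
    also have "(\<Sum>d\<in>?N. ?h d) \<le> 2 * C"
    proof -
      have "(\<Sum>d\<in>?N. ?h d) \<le> (\<Sum>d\<in>?N. 2 * ?g d)" by (intro sum_mono h2)
      also have "\<dots> = 2 * (\<Sum>d\<in>?N. ?g d)" by (rule sum_distrib_left[symmetric])
      finally show ?thesis using C[of y] by linarith
    qed
    also have "?h 3 \<le> 1"
      using mangoldt_prime[of 3] ln_le_minus_one[of 3] by (simp add: chi3_def)
    finally show ?thesis by simp
  qed
  then show ?thesis by blast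
qed

text \<open>These are primes that split in the Eisenstein integers. The bounded ratio of the
  endpoints keeps p^-\<sigma> within the factor B^-\<sigma> of X^-\<sigma>.\<close>

definition prime_window :: "real \<Rightarrow> real \<Rightarrow> nat set" where
  "prime_window B X = {p. prime p \<and> p mod 3 = 1 \<and> X < real p \<and> real p \<le> B * X}"

lemma finite_prime_window: "finite (prime_window B X)"
proof (rule finite_subset)
  show "prime_window B X \<subseteq> {p. real p \<le> B * X}" by (auto simp: prime_window_def)
  show "finite {p. real p \<le> B * X}"
    by (simp add: finite_nat_set_iff_bounded_le) (use le_nat_floor in blast)
qed

text \<open>Mertens' theorem makes the sum of ln p / p over the window at least 1, while no single
  term exceeds ln (B X) / X.\<close>

lemma card_primes_1_mod_3_ge:
  "\<exists>B\<ge>1. \<forall>X\<ge>1. X \<le> real (card (prime_window B X)) * ln (B * X)"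
proof -
  obtain C :: real where C: "\<forall>x\<ge>1. \<forall>y\<ge>x.
      2 * (\<Sum>p | prime p \<and> p mod 3 = 1 \<and> x < p \<and> p \<le> y. ln (real p) / real p) \<ge> ln (real y) - ln (real x) - C"
    using mertens_1_mod_3 by (rule exE)
  \<comment> \<open>The exponent makes half of ln B - C at least 1, whatever the sign of C.\<close>
  obtain B :: nat where B: "real B \<ge> exp (2 + \<bar>C\<bar>)" using real_arch_simple[of "exp (2 + \<bar>C\<bar>)"] by blast
  have B1: "B \<ge> 1" using B exp_gt_zero[of "2 + \<bar>C\<bar>"] by (cases B) auto
  have "X \<le> real (card (prime_window (2 * B) X)) * ln ((2 * B) * X)"
    if X: "X \<ge> 1" for X :: real
  proof -
    \<comment> \<open>Mertens' theorem above has integer endpoints. Rounding \<open>X\<close> up at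
      most doubles it, so the final ratio is 2B.\<close>
    define n where "n = nat \<lceil>X\<rceil>"
    have n: "X \<le> n" "n \<le> 2 * X" "n \<ge> 1" using X unfolding n_def by linarith+
    let ?W = "{p. prime p \<and> p mod 3 = 1 \<and> n < p \<and> p \<le> B * n}"
    let ?V = "prime_window (2 * B) X"
    let ?L = "ln ((2 * B) * X)"
    have BX: "real (B * n) \<le> (2 * B) * X" using n B1 by simp
    have "ln (real B) \<ge> 2 + \<bar>C\<bar>" using B B1 by (subst ln_ge_iff) auto
    then have "ln (B * n) - ln n \<ge> 2 + C" using B1 n by (simp add: ln_mult)
    then have "1 \<le> (\<Sum>p\<in>?W. ln p / p)" using C[rule_format, of n "B * n"] n B1 by simp
    also have "\<dots> \<le> (\<Sum>p\<in>?W. ?L / X)"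
    proof (intro sum_mono)
      fix p assume "p \<in> ?W"
      then have p: "n < p" "p \<le> B * n" by auto
      then have "X \<le> p" "real p \<le> (2 * B) * X" using n BX by linarith+
      moreover from this have "ln p \<le> ?L" "0 \<le> ln p"
        using X ln_mono[of "real p" "(2 * B) * X"] by auto
      ultimately show "ln p / p \<le> ?L / X" using X by (intro frac_le) auto
    qed
    also have "\<dots> = card ?W * ?L / X" by simp
    finally have "X \<le> card ?W * ?L" using X by (simp add: field_simps)
    also have "\<dots> \<le> card ?V * ?L"
    proof (intro mult_right_mono)
      have "?W \<subseteq> ?V"
      proof
        fix p assume p: "p \<in> ?W"
        then have "real n < real p" "real p \<le> real (B * n)"
          by (simp_all only: mem_Collect_eq of_nat_le_iff of_nat_less_iff)
        then have "X < real p" "real p \<le> (2 * B) * X" using n(1) BX by linarith+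
        then show "p \<in> ?V" using p by (simp add: prime_window_def)
      qed
      then show "real (card ?W) \<le> real (card ?V)" by (simp add: card_mono finite_prime_window)
      have "1 * 1 \<le> (2 * B) * X" using X B1 by (intro mult_mono) auto
      then show "?L \<ge> 0" by simp
    qed
    finally show ?thesis .
  qed
  then show ?thesis using B1 by (intro exI[of _ "real (2 * B)"]) auto
qed

subsection \<open>Prime ideals of the Eisenstein integers\<close>

lemma zeta3_eq: "\<zeta>\<^sub>3 = Complex (- 1 / 2) (sqrt 3 / 2)"
  by (simp add: \<zeta>\<^sub>3_def complex_eq_iff Re_exp Im_exp cos_120 sin_120)

lemma eisenstein_eq_iff:
  "of_int a + of_int b * \<zeta>\<^sub>3 = of_int c + of_int d * \<zeta>\<^sub>3 \<longleftrightarrow> a = c \<and> b = d"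
  by (auto simp: zeta3_eq complex_eq_iff)

lemma eisenstein_mult:
  "(of_int a + of_int b * \<zeta>\<^sub>3) * (of_int c + of_int d * \<zeta>\<^sub>3)
    = of_int (a * c - b * d) + of_int (a * d + b * c - b * d) * \<zeta>\<^sub>3"
proof -
  have "(of_int a + of_int b * \<zeta>\<^sub>3) * (of_int c + of_int d * \<zeta>\<^sub>3)
      = of_int a * of_int c + of_int (a * d + b * c) * \<zeta>\<^sub>3 + of_int b * of_int d * (\<zeta>\<^sub>3 * \<zeta>\<^sub>3)"
    by (simp add: algebra_simps)
  also have "\<dots> = of_int (a * c - b * d) + of_int (a * d + b * c - b * d) * \<zeta>\<^sub>3"
    by (simp add: zeta3_square algebra_simps)
  finally show ?thesis .
qed

lemma eisenstein_in_O\<^sub>k [intro, simp]: "of_int a + of_int b * \<zeta>\<^sub>3 \<in> carrier O\<^sub>k"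
  by (auto simp: mem_O\<^sub>k_iff)

lemma of_int_in_O\<^sub>k [intro, simp]: "of_int a \<in> carrier O\<^sub>k"
  using eisenstein_in_O\<^sub>k[of a 0] by simp

lemma of_nat_in_O\<^sub>k [intro, simp]: "of_nat a \<in> carrier O\<^sub>k"
  using of_int_in_O\<^sub>k[of "int a"] by simp

lemma zeta3_in_O\<^sub>k [intro, simp]: "\<zeta>\<^sub>3 \<in> carrier O\<^sub>k"
  using eisenstein_in_O\<^sub>k[of 0 1] by simp

lemma O\<^sub>k_ring: "ring O\<^sub>k"
  using O\<^sub>k_cring by (rule cring.axioms)

lemma O\<^sub>k_uminus:
  assumes "x \<in> carrier O\<^sub>k"
  shows "- x \<in> carrier O\<^sub>k" "\<ominus>\<^bsub>O\<^sub>k\<^esub> x = - x"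
proof -
  obtain a b where "x = of_int a + of_int b * \<zeta>\<^sub>3" using assms by (auto simp: mem_O\<^sub>k_iff)
  then have "- x = of_int (- a) + of_int (- b) * \<zeta>\<^sub>3" by simp
  then show "- x \<in> carrier O\<^sub>k" by (metis eisenstein_in_O\<^sub>k)
  then show "\<ominus>\<^bsub>O\<^sub>k\<^esub> x = - x"
    using assms abelian_group.minus_equality[OF ring.is_abelian_group[OF O\<^sub>k_ring], of "- x" x]
    by simp
qed

lemma ideal_O\<^sub>kD:
  assumes "ideal I O\<^sub>k"
  shows "I \<subseteq> carrier O\<^sub>k" "0 \<in> I"
    "\<And>x y. x \<in> I \<Longrightarrow> y \<in> I \<Longrightarrow> x + y \<in> I"
    "\<And>x y. x \<in> I \<Longrightarrow> y \<in> I \<Longrightarrow> x - y \<in> I"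
    "\<And>x y. x \<in> I \<Longrightarrow> y \<in> carrier O\<^sub>k \<Longrightarrow> y * x \<in> I"
proof -
  interpret ideal I O\<^sub>k by fact
  show sub: "I \<subseteq> carrier O\<^sub>k" using Icarr by blast
  show "0 \<in> I" using additive_subgroup.zero_closed[OF ideal.axioms(1)[OF assms]] by simp
  show add: "x + y \<in> I" if "x \<in> I" "y \<in> I" for x y
    using additive_subgroup.a_closed[OF ideal.axioms(1)[OF assms] that] by simp
  show mult: "y * x \<in> I" if "x \<in> I" "y \<in> carrier O\<^sub>k" for x y using I_l_closed[OF that] by simp
  show "x - y \<in> I" if "x \<in> I" "y \<in> I" for x y
    using add[OF that(1) mult[OF that(2) of_int_in_O\<^sub>k, of "- 1"]] by simp
qed

lemma O\<^sub>k_coset_eq_iff: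
  assumes "ideal I O\<^sub>k" "x \<in> carrier O\<^sub>k" "y \<in> carrier O\<^sub>k"
  shows "I +>\<^bsub>O\<^sub>k\<^esub> x = I +>\<^bsub>O\<^sub>k\<^esub> y \<longleftrightarrow> x - y \<in> I"
  using ring.quotient_eq_iff_same_a_r_cos[OF O\<^sub>k_ring assms] O\<^sub>k_uminus[OF assms(3)]
  by (simp add: a_minus_def)

lemma carrier_O\<^sub>k_Quot: "carrier (O\<^sub>k Quot I) = (\<lambda>x. I +>\<^bsub>O\<^sub>k\<^esub> x) ` carrier O\<^sub>k"
  by (auto simp: FactRing_def A_RCOSETS_def')

text \<open>When t is a root of t^2 + t + 1 mod p, this is the kernel of the ring homomorphism to
  the integers mod p that sends \<open>\<zeta>\<^sub>3\<close> to t, classically the ideal generated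
  by p and \<open>\<zeta>\<^sub>3 - t\<close>.\<close>

definition res_ideal :: "nat \<Rightarrow> int \<Rightarrow> complex set" where
  "res_ideal p t = {of_int a + of_int b * \<zeta>\<^sub>3 | a b. int p dvd a + b * t}"

lemma mem_res_ideal_iff: "of_int a + of_int b * \<zeta>\<^sub>3 \<in> res_ideal p t \<longleftrightarrow> int p dvd a + b * t"
  by (auto simp: res_ideal_def eisenstein_eq_iff)

lemma of_int_mem_res_ideal_iff: "of_int a \<in> res_ideal p t \<longleftrightarrow> int p dvd a"
  using mem_res_ideal_iff[of a 0] by simp

text \<open>Evaluation at t is multiplicative mod p: the value of the product and the product of the
  values differ by b d (t^2 + t + 1). Closure under multiplication and primality both rest on
  this.\<close>

lemma eisenstein_mult_mem_res_ideal_iff: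
  assumes "int p dvd t\<^sup>2 + t + 1"
  shows "(of_int a + of_int b * \<zeta>\<^sub>3) * (of_int c + of_int d * \<zeta>\<^sub>3) \<in> res_ideal p t
    \<longleftrightarrow> int p dvd (a + b * t) * (c + d * t)"
proof -
  have "(a + b * t) * (c + d * t)
      = (a * c - b * d + (a * d + b * c - b * d) * t) + b * d * (t\<^sup>2 + t + 1)"
    by (simp add: algebra_simps power2_eq_square)
  then show ?thesis
    unfolding eisenstein_mult mem_res_ideal_iff
    using dvd_add_left_iff[OF dvd_mult[OF assms, of "b * d"]] by simp
qed

lemma ideal_res_ideal:
  assumes "int p dvd t\<^sup>2 + t + 1"
  shows "ideal (res_ideal p t) O\<^sub>k"
proof (rule idealI)
  show "ring O\<^sub>k" by (rule O\<^sub>k_ring)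
  have sub: "res_ideal p t \<subseteq> carrier O\<^sub>k" by (auto simp: res_ideal_def)
  show "subgroup (res_ideal p t) (add_monoid O\<^sub>k)"
  proof
    show "res_ideal p t \<subseteq> carrier (add_monoid O\<^sub>k)" using sub by simp
    show "\<one>\<^bsub>add_monoid O\<^sub>k\<^esub> \<in> res_ideal p t" using of_int_mem_res_ideal_iff[of 0] by simp
  next
    fix x y assume "x \<in> res_ideal p t" "y \<in> res_ideal p t"
    then obtain a b c d where x: "x = of_int a + of_int b * \<zeta>\<^sub>3" "int p dvd a + b * t"
      and y: "y = of_int c + of_int d * \<zeta>\<^sub>3" "int p dvd c + d * t"
      by (auto simp: res_ideal_def)
    have "x + y = of_int (a + c) + of_int (b + d) * \<zeta>\<^sub>3" by (simp add: x y algebra_simps)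
    moreover have "int p dvd (a + c) + (b + d) * t"
      using dvd_add[OF x(2) y(2)] by (simp add: algebra_simps)
    ultimately have "x + y \<in> res_ideal p t" by (simp only: mem_res_ideal_iff)
    then show "x \<otimes>\<^bsub>add_monoid O\<^sub>k\<^esub> y \<in> res_ideal p t" by simp
  next
    fix x assume x0: "x \<in> res_ideal p t"
    then obtain a b where x: "x = of_int a + of_int b * \<zeta>\<^sub>3" "int p dvd a + b * t"
      by (auto simp: res_ideal_def)
    have "- x = of_int (- a) + of_int (- b) * \<zeta>\<^sub>3" by (simp add: x)
    moreover have "int p dvd (- a) + (- b) * t"
      using x(2) by (metis dvd_minus_iff minus_add_distrib minus_mult_left)
    ultimately have "- x \<in> res_ideal p t" by (metis mem_res_ideal_iff)
    then show "inv\<^bsub>add_monoid O\<^sub>k\<^esub> x \<in> res_ideal p t"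
      using O\<^sub>k_uminus(2)[of x] x0 sub by (auto simp: a_inv_def)
  qed
  have closed: "x * y \<in> res_ideal p t" if x: "x \<in> res_ideal p t" and y: "y \<in> carrier O\<^sub>k" for x y
  proof -
    obtain a b where "x = of_int a + of_int b * \<zeta>\<^sub>3" "int p dvd a + b * t"
      using x by (auto simp: res_ideal_def)
    moreover obtain c d where "y = of_int c + of_int d * \<zeta>\<^sub>3"
      using y by (auto simp: mem_O\<^sub>k_iff)
    ultimately show ?thesis using eisenstein_mult_mem_res_ideal_iff[OF assms, of a b c d] by simp
  qed
  show "x \<otimes>\<^bsub>O\<^sub>k\<^esub> a \<in> res_ideal p t" if "a \<in> res_ideal p t" "x \<in> carrier O\<^sub>k" for a x
    using closed[OF that] by (simp add: mult.commute)
  show "a \<otimes>\<^bsub>O\<^sub>k\<^esub> x \<in> res_ideal p t" if "a \<in> res_ideal p t" "x \<in> carrier O\<^sub>k" for a x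
    using closed[OF that] by simp
qed

text \<open>Primality is Euclid's lemma for \<open>p\<close> after evaluation at \<open>t\<close>.
  To divide is to be contained in: a divisor of the ideal generated by 3 contains 3, which would
  force \<open>p = 3\<close>.\<close>

lemma res_ideal_in_primes_not_dvd_3:
  assumes p: "prime p" "p \<noteq> 3" and t: "int p dvd t\<^sup>2 + t + 1"
  shows "res_ideal p t \<in> primes_not_dvd_3"
proof -
  have P: "ideal (res_ideal p t) O\<^sub>k" by (rule ideal_res_ideal[OF t])
  have "primeideal (res_ideal p t) O\<^sub>k"
  proof (rule primeidealI[OF P O\<^sub>k_cring])
    have "of_int 1 \<notin> res_ideal p t"
      unfolding of_int_mem_res_ideal_iff using p by (auto simp: prime_nat_iff)
    then show "carrier O\<^sub>k \<noteq> res_ideal p t" using of_int_in_O\<^sub>k by blast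
  next
    fix x y assume "x \<in> carrier O\<^sub>k" "y \<in> carrier O\<^sub>k" and xy: "x \<otimes>\<^bsub>O\<^sub>k\<^esub> y \<in> res_ideal p t"
    then obtain a b c d where eq: "x = of_int a + of_int b * \<zeta>\<^sub>3" "y = of_int c + of_int d * \<zeta>\<^sub>3"
      by (auto simp: mem_O\<^sub>k_iff)
    then have "int p dvd (a + b * t) * (c + d * t)"
      using xy eisenstein_mult_mem_res_ideal_iff[OF t, of a b c d] by simp
    then have "int p dvd a + b * t \<or> int p dvd c + d * t"
      using p by (simp add: prime_dvd_mult_iff)
    then show "x \<in> res_ideal p t \<or> y \<in> res_ideal p t" by (simp add: eq mem_res_ideal_iff)
  qed
  moreover have "res_ideal p t \<noteq> {0}"
  proof -
    have "of_int (int p) \<in> res_ideal p t" by (simp only: of_int_mem_res_ideal_iff dvd_refl)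
    moreover have "(of_int (int p) :: complex) \<noteq> 0" using p by (auto simp: prime_nat_iff)
    ultimately show ?thesis by (metis singletonD)
  qed
  moreover have "\<not> ideal_dvd (res_ideal p t) (PIdl\<^bsub>O\<^sub>k\<^esub> 3)"
  proof
    assume "ideal_dvd (res_ideal p t) (PIdl\<^bsub>O\<^sub>k\<^esub> 3)"
    then obtain K where "ideal K O\<^sub>k" "PIdl\<^bsub>O\<^sub>k\<^esub> 3 = ideal_prod O\<^sub>k (res_ideal p t) K"
      by (auto simp: ideal_dvd_def)
    then have "PIdl\<^bsub>O\<^sub>k\<^esub> 3 \<subseteq> res_ideal p t" using ring.ideal_prod_inter[OF O\<^sub>k_ring P] by auto
    moreover have "3 \<in> PIdl\<^bsub>O\<^sub>k\<^esub> 3"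
      using ring.cgenideal_self[OF O\<^sub>k_ring, of 3] of_int_in_O\<^sub>k[of 3] by simp
    ultimately have "int p dvd int 3" using of_int_mem_res_ideal_iff[of 3 p t] by auto
    then have "p dvd 3" by (simp only: int_dvd_int_iff)
    then have "p = 3" using p by (simp add: primes_dvd_imp_eq)
    then show False using p by simp
  qed
  ultimately show ?thesis by (simp add: primes_not_dvd_3_def)
qed

text \<open>Modulo the ideal, \<open>\<zeta>\<^sub>3\<close> is congruent to \<open>t\<close>, so
  every class contains exactly one of the integers 0, ..., p - 1.\<close>

lemma ideal_norm_res_ideal:
  assumes p: "p > 0" and t: "int p dvd t\<^sup>2 + t + 1"
  shows "ideal_norm (res_ideal p t) = p"
proof -
  let ?P = "res_ideal p t"
  let ?c = "\<lambda>i::int. ?P +>\<^bsub>O\<^sub>k\<^esub> of_int i"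
  have P: "ideal ?P O\<^sub>k" by (rule ideal_res_ideal[OF t])
  have "bij_betw ?c {0..<int p} (carrier (O\<^sub>k Quot ?P))"
    unfolding bij_betw_def
  proof (intro conjI inj_onI subset_antisym subsetI)
    fix i j assume ij: "i \<in> {0..<int p}" "j \<in> {0..<int p}" "?c i = ?c j"
    then have "of_int (i - j) \<in> ?P" using O\<^sub>k_coset_eq_iff[OF P, of "of_int i" "of_int j"] by simp
    then have "int p dvd i - j" by (simp only: of_int_mem_res_ideal_iff)
    then show "i = j" using ij by (metis atLeastLessThan_iff mod_eq_dvd_iff mod_pos_pos_trivial)
  next
    fix C assume "C \<in> carrier (O\<^sub>k Quot ?P)"
    then obtain a b where C: "C = ?P +>\<^bsub>O\<^sub>k\<^esub> (of_int a + of_int b * \<zeta>\<^sub>3)"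
      by (auto simp: carrier_O\<^sub>k_Quot mem_O\<^sub>k_iff)
    define i where "i = (a + b * t) mod int p"
    have "(a - i) + b * t = (a + b * t) - (a + b * t) mod int p" by (simp add: i_def)
    then have "int p dvd (a - i) + b * t" by (simp only: dvd_minus_mod)
    then have "of_int (a - i) + of_int b * \<zeta>\<^sub>3 \<in> ?P" by (simp only: mem_res_ideal_iff)
    then have "(of_int a + of_int b * \<zeta>\<^sub>3) - of_int i \<in> ?P" by (simp add: algebra_simps)
    then have "C = ?c i" unfolding C by (subst O\<^sub>k_coset_eq_iff[OF P]) auto
    moreover have "i \<in> {0..<int p}" using p by (simp add: i_def)
    ultimately show "C \<in> ?c ` {0..<int p}" by blast
  qed (auto simp: carrier_O\<^sub>k_Quot)
  from bij_betw_same_card[OF this] show ?thesis by (simp add: ideal_norm_def)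
qed

text \<open>The power g^((p-1)/3) of a primitive root is a cube root of unity other than 1, hence a
  root of (h^3 - 1) / (h - 1).\<close>

lemma cube_root_of_unity_mod_prime:
  assumes p: "prime p" "p mod 3 = 1"
  obtains t :: int where "int p dvd t\<^sup>2 + t + 1"
proof -
  obtain g where g: "residue_primroot p g"
    using prime_primitive_root_exists[of p] prime_gt_1_nat[OF p(1)] p by auto
  then have ord: "ord p g = p - 1" "coprime p g"
    using p by (auto simp: residue_primroot_def totient_prime)
  define k where "k = (p - 1) div 3"
  have k: "3 * k = p - 1" unfolding k_def using p(2) by presburger
  have "p > 1" using p prime_gt_1_nat by blast
  then have k0: "k > 0" "k < p - 1" using k by auto
  define h where "h = int (g ^ k)"
  have "[g ^ (p - 1) = 1] (mod p)" using ord_works[of g p] ord(1) by simp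
  then have "[h ^ 3 = 1] (mod int p)"
    unfolding h_def by (metis cong_int_iff k mult.commute of_nat_1 of_nat_power power_mult)
  then have "int p dvd (h - 1) * (h\<^sup>2 + h + 1)"
    by (simp add: cong_iff_dvd_diff algebra_simps power2_eq_square power3_eq_cube)
  moreover have "\<not> int p dvd h - 1"
  proof
    assume "int p dvd h - 1"
    then have "[g ^ k = 1] (mod p)"
      unfolding h_def by (metis cong_iff_dvd_diff cong_int_iff of_nat_1)
    then have "ord p g dvd k" by (simp only: ord_divides)
    then show False using ord k0 by (simp add: nat_dvd_not_less)
  qed
  ultimately have "int p dvd h\<^sup>2 + h + 1" using p by (simp add: prime_dvd_mult_iff)
  then show ?thesis by (rule that)
qed

lemma prime_ideal_of_norm:
  assumes "prime p" "p mod 3 = 1"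
  obtains P where "P \<in> primes_not_dvd_3" "ideal_norm P = p"
proof -
  obtain t where "int p dvd t\<^sup>2 + t + 1" using cube_root_of_unity_mod_prime[OF assms] .
  then show ?thesis
    using assms by (intro that[OF res_ideal_in_primes_not_dvd_3 ideal_norm_res_ideal]) (auto simp: prime_gt_0_nat)
qed

section \<open>Prime ideals above a given rational prime\<close>

definition under_prime :: "complex set \<Rightarrow> nat" where
  "under_prime P = (LEAST n. n > 0 \<and> of_nat n \<in> P)"

text \<open>The norm of a nonzero element is a positive integer in \<open>P\<close>, so the minimum
  exists; division with remainder shows that it generates the integers in \<open>P\<close>, and it
  inherits primality from \<open>P\<close>.\<close>

lemma under_prime:
  assumes P: "primeideal P O\<^sub>k" "P \<noteq> {0}"
  shows "prime (under_prime P)" "of_int m \<in> P \<longleftrightarrow> int (under_prime P) dvd m"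
proof -
  interpret primeideal P O\<^sub>k by fact
  have P': "ideal P O\<^sub>k" by (rule is_ideal)
  note PD = ideal_O\<^sub>kD[OF P']
  define p where "p = under_prime P"
  obtain x where x: "x \<in> P" "x \<noteq> 0" using PD(2) P(2) by blast
  have "x \<in> carrier O\<^sub>k" using x PD(1) by blast
  then obtain a b where ab: "x = of_int a + of_int b * \<zeta>\<^sub>3" by (auto simp: mem_O\<^sub>k_iff)
  \<comment> \<open>The norm of \<open>x\<close>; the cofactor below is the complex conjugate of
    \<open>x\<close>.\<close>
  define n where "n = a\<^sup>2 - a * b + b\<^sup>2"
  have "(of_int (a - b) + of_int (- b) * \<zeta>\<^sub>3) * x \<in> P" using x PD(5) by blast
  also have "(of_int (a - b) + of_int (- b) * \<zeta>\<^sub>3) * x = of_int n + of_int 0 * \<zeta>\<^sub>3"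
    unfolding ab eisenstein_mult eisenstein_eq_iff n_def by (auto simp: algebra_simps power2_eq_square)
  finally have "of_int n \<in> P" by simp
  moreover have "n > 0"
  proof -
    have "4 * n = (2 * a - b)\<^sup>2 + 3 * b\<^sup>2" by (simp add: n_def power2_eq_square algebra_simps)
    moreover have "(2 * a - b)\<^sup>2 + 3 * b\<^sup>2 > 0"
    proof (cases "b = 0")
      case True
      then have "a \<noteq> 0" using x ab by auto
      then show ?thesis using True by simp
    qed (simp add: add_nonneg_pos)
    ultimately show ?thesis by linarith
  qed
  ultimately have "nat n > 0 \<and> of_nat (nat n) \<in> P" by simp
  then have "p > 0 \<and> of_nat p \<in> P"
    unfolding p_def under_prime_def by (rule LeastI)
  then have p: "p > 0" "of_nat p \<in> P" by auto
  have least: "p \<le> k" if "k > 0" "of_nat k \<in> P" for k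
    unfolding p_def under_prime_def using that by (intro Least_le) auto
  have one: "1 \<notin> P"
    using I_notcarr one_imp_carrier by auto
  have dvd: "of_int m \<in> P \<longleftrightarrow> int p dvd m" for m
  proof
    assume m: "of_int m \<in> P"
    have "of_int (m div int p) * of_nat p \<in> P" using p by (intro PD(5)) auto
    then have "of_int m - of_int (m div int p) * of_nat p \<in> P" using m PD(4) by blast
    also have "of_int m - of_int (m div int p) * of_nat p = (of_int (m mod int p) :: complex)"
      by (metis minus_div_mult_eq_mod of_int_diff of_int_mult of_int_of_nat_eq)
    also have "\<dots> = of_nat (nat (m mod int p))" using p by simp
    finally have "of_nat (nat (m mod int p)) \<in> P" .
    moreover have "nat (m mod int p) < p" using p by (simp add: nat_less_iff)
    ultimately have "nat (m mod int p) = 0" using least leD by blast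
    then show "int p dvd m" using p by (simp add: dvd_eq_mod_eq_0 nat_eq_iff split: if_splits)
  next
    assume "int p dvd m"
    then obtain k where "m = k * int p" by (metis dvd_def mult.commute)
    then have "of_int m = of_int k * (of_nat p :: complex)" by simp
    then show "of_int m \<in> P" using PD(5)[OF p(2), of "of_int k"] by simp
  qed
  then show "of_int m \<in> P \<longleftrightarrow> int (under_prime P) dvd m" by (simp add: p_def)
  have "prime p"
  proof (rule prime_natI)
    show "2 \<le> p" using one p by (cases "p = 1") auto
    fix m n assume mn: "p dvd m * n"
    have "of_int (int m * int n) \<in> P" unfolding dvd using mn by (metis int_dvd_int_iff of_nat_mult)
    then have "of_int (int m) \<in> P \<or> of_int (int n) \<in> P"
      using I_prime[of "of_int (int m)" "of_int (int n)"] of_int_in_O\<^sub>k by simp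
    then show "p dvd m \<or> p dvd n" unfolding dvd by simp
  qed
  then show "prime (under_prime P)" by (simp add: p_def)
qed

text \<open>The integers 0, ..., p - 1 lie in distinct classes. As \<open>card\<close> is 0 on
  infinite sets, the quotient must also be shown finite, which follows by reducing both coefficients
  mod p.\<close>

lemma under_prime_le_ideal_norm:
  assumes P: "primeideal P O\<^sub>k" "P \<noteq> {0}"
  shows "under_prime P \<le> ideal_norm P"
proof -
  have P': "ideal P O\<^sub>k" using P(1) by (rule primeideal.axioms)
  note PD = ideal_O\<^sub>kD[OF P']
  define p where "p = under_prime P"
  have p: "p > 0" "\<And>m. of_int m \<in> P \<longleftrightarrow> int p dvd m"
    using under_prime[OF P] by (auto simp: p_def prime_gt_0_nat)
  let ?c = "\<lambda>x. P +>\<^bsub>O\<^sub>k\<^esub> x"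
  have "carrier (O\<^sub>k Quot P) \<subseteq> (\<lambda>(a,b). ?c (of_int a + of_int b * \<zeta>\<^sub>3)) ` ({0..<int p} \<times> {0..<int p})"
  proof
    fix C assume "C \<in> carrier (O\<^sub>k Quot P)"
    then obtain a b where C: "C = ?c (of_int a + of_int b * \<zeta>\<^sub>3)"
      by (auto simp: carrier_O\<^sub>k_Quot mem_O\<^sub>k_iff)
    let ?a = "a mod int p" and ?b = "b mod int p"
    have "of_int (a - ?a) \<in> P" "of_int (b - ?b) \<in> P" by (simp_all only: p(2) dvd_minus_mod)
    then have "of_int (a - ?a) + \<zeta>\<^sub>3 * of_int (b - ?b) \<in> P" using PD(3,5) zeta3_in_O\<^sub>k by blast
    then have "(of_int a + of_int b * \<zeta>\<^sub>3) - (of_int ?a + of_int ?b * \<zeta>\<^sub>3) \<in> P"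
      by (simp add: algebra_simps)
    then have "C = ?c (of_int ?a + of_int ?b * \<zeta>\<^sub>3)"
      unfolding C using O\<^sub>k_coset_eq_iff[OF P'] by blast
    then show "C \<in> (\<lambda>(a,b). ?c (of_int a + of_int b * \<zeta>\<^sub>3)) ` ({0..<int p} \<times> {0..<int p})"
      using p(1) by (intro image_eqI[of _ _ "(?a, ?b)"]) auto
  qed
  then have fin: "finite (carrier (O\<^sub>k Quot P))" by (rule finite_subset) auto
  have "card {0..<int p} \<le> card (carrier (O\<^sub>k Quot P))"
  proof (rule card_inj_on_le[OF _ _ fin, of "\<lambda>i. ?c (of_int i)"])
    show "inj_on (\<lambda>i. ?c (of_int i)) {0..<int p}"
    proof (rule inj_onI)
      fix i j assume ij: "i \<in> {0..<int p}" "j \<in> {0..<int p}" "?c (of_int i) = ?c (of_int j)"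
      then have "of_int (i - j) \<in> P" using O\<^sub>k_coset_eq_iff[OF P', of "of_int i" "of_int j"] by simp
      then have "int p dvd i - j" by (simp only: p)
      then show "i = j" using ij by (metis atLeastLessThan_iff mod_eq_dvd_iff mod_pos_pos_trivial)
    qed
  qed (auto simp: carrier_O\<^sub>k_Quot)
  then show ?thesis by (simp add: ideal_norm_def p_def)
qed

definition inert_ideal :: "nat \<Rightarrow> complex set" where
  "inert_ideal p = {of_int a + of_int b * \<zeta>\<^sub>3 | a b. int p dvd a \<and> int p dvd b}"

text \<open>If some element has a \<open>\<zeta>\<^sub>3\<close>-coefficient prime to p, inverting
  that coefficient mod p puts \<open>\<zeta>\<^sub>3 - t\<close> into \<open>P\<close> for an
  integer t, so membership is decided by evaluation at t. Otherwise both coefficients of every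
  element are multiples of p.\<close>

lemma primeideal_cases:
  assumes P: "primeideal P O\<^sub>k" "P \<noteq> {0}"
  defines "p \<equiv> under_prime P"
  shows "P = inert_ideal p \<or> (\<exists>t. int p dvd t\<^sup>2 + t + 1 \<and> P = res_ideal p t)"
proof -
  have P': "ideal P O\<^sub>k" using P(1) by (rule primeideal.axioms)
  note PD = ideal_O\<^sub>kD[OF P']
  have p: "prime p" "\<And>m. of_int m \<in> P \<longleftrightarrow> int p dvd m"
    using under_prime[OF P] by (auto simp: p_def)
  show ?thesis
  proof (cases "\<forall>a b. of_int a + of_int b * \<zeta>\<^sub>3 \<in> P \<longrightarrow> int p dvd b")
    case True
    have "of_int a + of_int b * \<zeta>\<^sub>3 \<in> P \<longleftrightarrow> int p dvd a \<and> int p dvd b" for a b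
    proof
      assume ab: "of_int a + of_int b * \<zeta>\<^sub>3 \<in> P"
      then have b: "int p dvd b" using True by blast
      then have "\<zeta>\<^sub>3 * of_int b \<in> P" using PD(5) p(2) zeta3_in_O\<^sub>k by blast
      from PD(4)[OF ab this] have "of_int a \<in> P" by (simp add: mult.commute)
      then show "int p dvd a \<and> int p dvd b" using b p(2) by blast
    next
      assume "int p dvd a \<and> int p dvd b"
      then have "of_int a + \<zeta>\<^sub>3 * of_int b \<in> P" using PD(3,5) p(2) zeta3_in_O\<^sub>k by blast
      then show "of_int a + of_int b * \<zeta>\<^sub>3 \<in> P" by (simp add: mult.commute)
    qed
    moreover have "x \<in> P \<Longrightarrow> \<exists>a b. x = of_int a + of_int b * \<zeta>\<^sub>3" for x
      using PD(1) by (auto simp: mem_O\<^sub>k_iff)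
    ultimately have "P = inert_ideal p"
      unfolding inert_ideal_def by blast
    then show ?thesis ..
  next
    case False
    then obtain a b where ab: "of_int a + of_int b * \<zeta>\<^sub>3 \<in> P" "\<not> int p dvd b" by blast
    then have "coprime b (int p)" using prime_imp_coprime[of "int p" b] p(1) by (simp add: coprime_commute)
    then obtain c where "[b * c = 1] (mod int p)" using cong_solve_coprime_int by blast
    then have bc: "int p dvd b * c - 1" by (simp add: cong_iff_dvd_diff)
    define t where "t = - (c * a)"
    have "of_int c * (of_int a + of_int b * \<zeta>\<^sub>3) - \<zeta>\<^sub>3 * of_int (b * c - 1) \<in> P"
      using PD(4) PD(5)[OF ab(1) of_int_in_O\<^sub>k, of c] PD(5)[OF _ zeta3_in_O\<^sub>k] bc p(2) by blast
    then have zt: "\<zeta>\<^sub>3 - of_int t \<in> P" by (simp add: t_def algebra_simps)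
    \<comment> \<open>The cofactor is the complex conjugate of \<open>\<zeta>\<^sub>3 - t\<close>,
      so the product is a norm.\<close>
    have "(of_int (- 1 - t) + of_int (- 1) * \<zeta>\<^sub>3) * (\<zeta>\<^sub>3 - of_int t) \<in> P"
      using PD(5)[OF zt] by blast
    also have "(of_int (- 1 - t) + of_int (- 1) * \<zeta>\<^sub>3) * (\<zeta>\<^sub>3 - of_int t) = of_int (t\<^sup>2 + t + 1)"
      using eisenstein_mult[of "- 1 - t" "- 1" "- t" 1] by (simp add: algebra_simps power2_eq_square)
    finally have t: "int p dvd t\<^sup>2 + t + 1" using p(2) by blast
    have "of_int a + of_int b * \<zeta>\<^sub>3 \<in> P \<longleftrightarrow> int p dvd a + b * t" for a b
    proof -
      have eq: "of_int a + of_int b * \<zeta>\<^sub>3 = of_int (a + b * t) + of_int b * (\<zeta>\<^sub>3 - of_int t)"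
        by (simp add: algebra_simps)
      have bz: "of_int b * (\<zeta>\<^sub>3 - of_int t) \<in> P" using PD(5)[OF zt] by blast
      show ?thesis
        unfolding p(2)[symmetric] eq using PD(3)[OF _ bz] PD(4)[OF _ bz] by fastforce
    qed
    moreover have "x \<in> P \<Longrightarrow> \<exists>a b. x = of_int a + of_int b * \<zeta>\<^sub>3" for x
      using PD(1) by (auto simp: mem_O\<^sub>k_iff)
    ultimately have "P = res_ideal p t"
      unfolding res_ideal_def by blast
    then show ?thesis using t by blast
  qed
qed

lemma res_ideal_cong: "[t = u] (mod int p) \<Longrightarrow> res_ideal p t = res_ideal p u"
proof -
  assume "[t = u] (mod int p)"
  then have "int p dvd a + b * t \<longleftrightarrow> int p dvd a + b * u" for a b
    by (meson cong_add cong_dvd_iff cong_mult cong_refl cong_modulus_mult)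
  then show ?thesis by (simp add: res_ideal_def)
qed

text \<open>A quadratic has at most two roots mod a prime; by Vieta the second root of t^2 + t + 1
  is -1 - u. With the inert candidate this leaves three ideals.\<close>

lemma card_primeideal_over_le:
  "finite {P. primeideal P O\<^sub>k \<and> P \<noteq> {0} \<and> under_prime P = p}" (is "finite ?S")
  "card {P. primeideal P O\<^sub>k \<and> P \<noteq> {0} \<and> under_prime P = p} \<le> 3"
proof -
  \<comment> \<open>Without a root mod p, \<open>u\<close> is an unspecified integer; its two ideals
    then merely enlarge the set of candidates.\<close>
  define u where "u = (SOME t. int p dvd t\<^sup>2 + t + 1)"
  let ?T = "{inert_ideal p, res_ideal p u, res_ideal p (- 1 - u)}"
  have "?S \<subseteq> ?T"
  proof
    fix P assume P: "P \<in> ?S"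
    then have pr: "prime p" using under_prime(1) by blast
    have "P = inert_ideal p \<or> (\<exists>t. int p dvd t\<^sup>2 + t + 1 \<and> P = res_ideal p t)"
      using P primeideal_cases by blast
    then show "P \<in> ?T"
    proof
      assume "\<exists>t. int p dvd t\<^sup>2 + t + 1 \<and> P = res_ideal p t"
      then obtain t where t: "int p dvd t\<^sup>2 + t + 1" "P = res_ideal p t" by blast
      then have "int p dvd u\<^sup>2 + u + 1" unfolding u_def by (rule_tac someI)
      from dvd_diff[OF t(1) this] have "int p dvd (t - u) * (t - (- 1 - u))"
        by (simp add: algebra_simps power2_eq_square)
      then have "[t = u] (mod int p) \<or> [t = - 1 - u] (mod int p)"
        using pr by (simp add: prime_dvd_mult_iff cong_iff_dvd_diff)
      then show ?thesis using t res_ideal_cong by auto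
    qed auto
  qed
  moreover have "card ?T \<le> 3" by (simp add: card_insert_if)
  ultimately show "finite ?S" "card ?S \<le> 3"
    using finite_subset card_mono[of ?T ?S] by (auto simp del: card_insert_if)
qed

lemma ideal_norm_ge_2: "P \<in> primes_not_dvd_3 \<Longrightarrow> ideal_norm P \<ge> 2"
  using under_prime(1) under_prime_le_ideal_norm prime_ge_2_nat order.trans
  unfolding primes_not_dvd_3_def by blast

lemma summable_ideal_norm_powr:
  assumes "a > 1"
  shows "(\<lambda>P. real (ideal_norm P) powr - a) summable_on primes_not_dvd_3"
proof (rule nonneg_bdd_above_summable_on)
  let ?g = "\<lambda>P. real (ideal_norm P) powr - a"
  let ?h = "\<lambda>n::nat. 3 * real n powr - a"
  have sm: "summable ?h"
    using assms by (intro summable_mult) (simp add: summable_real_powr_iff)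
  have "sum ?g F \<le> suminf ?h" if F: "F \<subseteq> primes_not_dvd_3" "finite F" for F
  proof -
    have D: "primeideal P O\<^sub>k" "P \<noteq> {0}" if "P \<in> F" for P
      using that F by (auto simp: primes_not_dvd_3_def)
    have "sum ?g F \<le> (\<Sum>P\<in>F. real (under_prime P) powr - a)"
    proof (intro sum_mono powr_mono2')
      fix P assume "P \<in> F"
      note D = D[OF this]
      show "0 < real (under_prime P)" using under_prime(1)[OF D] by (simp add: prime_gt_0_nat)
      show "real (under_prime P) \<le> real (ideal_norm P)" using under_prime_le_ideal_norm[OF D] by simp
    qed (use assms in auto)
    also have "\<dots> = (\<Sum>p\<in>under_prime ` F. \<Sum>P\<in>{P\<in>F. under_prime P = p}. real (under_prime P) powr - a)"
      by (rule sum.image_gen[OF F(2)])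
    also have "\<dots> \<le> (\<Sum>p\<in>under_prime ` F. ?h p)"
    proof (intro sum_mono)
      fix p
      have "(\<Sum>P\<in>{P\<in>F. under_prime P = p}. real (under_prime P) powr - a)
          = card {P\<in>F. under_prime P = p} * real p powr - a" by simp
      also have "card {P\<in>F. under_prime P = p} \<le> 3"
        using D by (intro order.trans[OF card_mono card_primeideal_over_le(2)[of p]] card_primeideal_over_le(1)) auto
      finally show "(\<Sum>P\<in>{P\<in>F. under_prime P = p}. real (under_prime P) powr - a) \<le> ?h p"
        by (simp add: mult_right_mono)
    qed
    also have "\<dots> \<le> suminf ?h" by (intro sum_le_suminf sm) (use F in auto)
    finally show ?thesis .
  qed
  then show "bdd_above (sum ?g ` {F. F \<subseteq> primes_not_dvd_3 \<and> finite F})"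
    by (intro bdd_aboveI[of _ "suminf ?h"]) auto
qed auto

subsection \<open>Unordered infinite products\<close>

text \<open>Factors of modulus at most 1 allow a difference of products to be bounded by the sum of
  the differences of the factors. The partial products thus form a Cauchy net without recourse to
  logarithms, and vanishing factors do no harm.\<close>

lemma tendsto_infprod:
  assumes sm: "(\<lambda>x. norm (f x - 1)) summable_on A" and le1: "\<And>x. x \<in> A \<Longrightarrow> norm (f x) \<le> 1"
  shows "((\<lambda>F. \<Prod>x\<in>F. f x) \<longlongrightarrow> infprod f A) (finite_subsets_at_top A)"
proof -
  let ?g = "\<lambda>x. norm (f x - 1)"
  obtain L where L: "(?g has_sum L) A" using sm by (auto simp: summable_on_def)
  have "\<exists>P. eventually P (finite_subsets_at_top A) \<and>
      (\<forall>F1 F2. P F1 \<and> P F2 \<longrightarrow> dist (prod f F1) (prod f F2) < e)" if "e > 0" for e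
  proof -
    have "\<forall>\<^sub>F F in finite_subsets_at_top A. dist (sum ?g F) L < e / 4"
      using L that unfolding has_sum_def by (intro tendstoD) auto
    then obtain F0 where F0: "finite F0" "F0 \<subseteq> A"
      and F0': "\<And>F. finite F \<Longrightarrow> F0 \<subseteq> F \<Longrightarrow> F \<subseteq> A \<Longrightarrow> dist (sum ?g F) L < e / 4"
      by (auto simp: eventually_finite_subsets_at_top)
    define P where "P F \<longleftrightarrow> finite F \<and> F0 \<subseteq> F \<and> F \<subseteq> A" for F
    have near: "dist (prod f F) (prod f F0) < e / 2" if "P F" for F
    proof -
      have F: "finite F" "F0 \<subseteq> F" "F \<subseteq> A" using that by (auto simp: P_def)
      \<comment> \<open>Padding the smaller product with ones lets both products run over the same
        index set.\<close>
      define h where "h x = (if x \<in> F0 then f x else 1)" for x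
      have "prod h F = prod f F0"
        unfolding h_def using F by (simp add: prod.If_cases Int_absorb1)
      then have "dist (prod f F) (prod f F0) = norm (prod f F - prod h F)" by (simp add: dist_norm)
      also have "\<dots> \<le> (\<Sum>x\<in>F. norm (f x - h x))"
        using F le1 by (intro norm_prod_diff) (auto simp: h_def)
      also have "\<dots> = (\<Sum>x\<in>F - F0. ?g x)"
        using F by (intro sum.mono_neutral_cong_right) (auto simp: h_def)
      also have "\<dots> = sum ?g F - sum ?g F0" using F F0 by (intro sum_diff) auto
      also have "\<dots> < e / 2"
        using F0'[OF F] F0'[OF F0(1) order.refl F0(2)] unfolding dist_real_def by linarith
      finally show ?thesis .
    qed
    have "eventually P (finite_subsets_at_top A)"
      using F0 by (auto simp: P_def eventually_finite_subsets_at_top)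
    moreover have "dist (prod f F1) (prod f F2) < e" if "P F1" "P F2" for F1 F2
      using near[OF that(1)] near[OF that(2)] dist_triangle2[of "prod f F1" "prod f F2" "prod f F0"] by simp
    ultimately show ?thesis by blast
  qed
  then have "cauchy_filter (filtermap (prod f) (finite_subsets_at_top A))"
    by (simp add: cauchy_filter_metric_filtermap)
  then obtain l where l: "((\<lambda>F. \<Prod>x\<in>F. f x) \<longlongrightarrow> l) (finite_subsets_at_top A)"
    using complete_uniform[where S = "UNIV :: complex set"] complete_UNIV
    by (force simp: filterlim_def)
  moreover from l have "infprod f A = l" unfolding infprod_def by (intro tendsto_Lim) auto
  ultimately show ?thesis by simp
qed

lemma norm_infprod_le:
  assumes "(\<lambda>x. norm (f x - 1)) summable_on A" "\<And>x. x \<in> A \<Longrightarrow> norm (f x) \<le> 1"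
    and F: "finite F" "F \<subseteq> A"
  shows "norm (infprod f A) \<le> (\<Prod>x\<in>F. norm (f x))"
proof (rule tendsto_upperbound[OF tendsto_norm[OF tendsto_infprod[OF assms(1,2)]]])
  show "\<forall>\<^sub>F G in finite_subsets_at_top A. norm (prod f G) \<le> (\<Prod>x\<in>F. norm (f x))"
    unfolding eventually_finite_subsets_at_top
  proof (intro exI[of _ F] conjI allI impI F)
    fix G assume G: "finite G \<and> F \<subseteq> G \<and> G \<subseteq> A"
    have "norm (prod f G) = (\<Prod>x\<in>F. norm (f x)) * (\<Prod>x\<in>G - F. norm (f x))"
      using G prod.subset_diff[of F G "\<lambda>x. norm (f x)"] by (simp add: prod_norm[symmetric] mult.commute)
    also have "\<dots> \<le> (\<Prod>x\<in>F. norm (f x)) * 1"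
      using G assms(2) by (intro mult_left_mono prod_le_1 prod_nonneg) auto
    finally show "norm (prod f G) \<le> (\<Prod>x\<in>F. norm (f x))" by simp
  qed
qed auto

subsection \<open>Local factors\<close>

text \<open>The phases are left arbitrary so that both cases share all estimates.\<close>

definition local_factor :: "nat \<Rightarrow> (nat \<Rightarrow> real) \<Rightarrow> complex" where
  "local_factor N \<theta> = 1 / (of_nat N + 1) + 1 / 3 * (of_nat N / (of_nat N + 1)) *
     (\<Sum>j = 0..2. exp (- \<i> * of_real (\<theta> j)))"

lemma norm_local_factor_le:
  "norm (local_factor N \<theta>)
    \<le> 1 / (real N + 1) + real N / (real N + 1) * (norm (\<Sum>j = 0..2. exp (- \<i> * of_real (\<theta> j))) / 3)"
proof -
  have N: "norm (of_nat N + 1 :: complex) = real N + 1"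
    using norm_of_nat[of "N + 1", where 'a = complex] by (simp add: add.commute)
  show ?thesis
    unfolding local_factor_def
    by (rule order.trans[OF norm_triangle_ineq]) (simp only: norm_mult norm_divide N norm_one norm_numeral norm_of_nat, simp add: mult.commute)
qed

lemma norm_local_factor_le_1: "norm (local_factor N \<theta>) \<le> 1"
proof -
  have "norm (\<Sum>j = 0..2. exp (- \<i> * of_real (\<theta> j))) \<le> (\<Sum>j = 0..2::nat. 1)"
    by (intro sum_norm_le) simp
  then have "N / (N + 1) * (norm (\<Sum>j = 0..2. exp (- \<i> * of_real (\<theta> j))) / 3) \<le> N / (N + 1) * 1"
    by (intro mult_left_mono) auto
  moreover have "1 / (real N + 1) + N / (real N + 1) * 1 = 1" by (simp add: field_simps)
  ultimately show ?thesis using norm_local_factor_le[of N \<theta>] by (simp add: add.commute)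
qed

text \<open>To first order in \<open>q = N\<^sup>-\<^sup>\<sigma>\<close> the phases of both cases are real parts of the three rotations of
  a number of modulus \<open>R = \<bar>y\<bar> q\<close> (Case 1) or \<open>R = \<bar>y\<bar> q log N\<close> (Case 2). These real parts cancel in
  the sum over \<open>j\<close>, so a local factor is \<open>1 + O(R\<^sup>2 + R q)\<close>; they are never all equal, which makes
  the factor smaller than 1 by a multiple of \<open>R\<^sup>2\<close>.\<close>

definition near_rotations :: "(nat \<Rightarrow> real) \<Rightarrow> real \<Rightarrow> real \<Rightarrow> bool" where
  "near_rotations \<theta> R q \<longleftrightarrow>
     (\<exists>u. norm u = R \<and> (\<forall>j. \<bar>\<theta> j - Re (\<zeta>\<^sub>3 ^ j * u)\<bar> \<le> 4 * R * q))"

lemma norm_zeta3 [simp]: "norm \<zeta>\<^sub>3 = 1"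
  by (simp add: \<zeta>\<^sub>3_def)

text \<open>Each phase is at most R + 4Rq \<le> 5R, so each exponential is linear up to 25R^2. The
  linear parts sum to the three errors alone, at most 12Rq, because the rotations cancel; the factor
  1/3 yields the constants.\<close>

lemma norm_local_factor_diff_1_le:
  assumes \<theta>: "near_rotations \<theta> R q" and q: "0 \<le> q" "q \<le> 1"
  shows "norm (local_factor N \<theta> - 1) \<le> 25 * R\<^sup>2 + 4 * R * q"
proof -
  obtain u where u: "norm u = R" "\<And>j. \<bar>\<theta> j - Re (\<zeta>\<^sub>3 ^ j * u)\<bar> \<le> 4 * R * q"
    using \<theta> by (auto simp: near_rotations_def)
  have R0: "R \<ge> 0" using u by auto
  define e where "e j = \<theta> j - Re (\<zeta>\<^sub>3 ^ j * u)" for j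
  let ?E = "\<lambda>j. exp (- \<i> * of_real (\<theta> j))"
  have N0: "(of_nat N + 1 :: complex) \<noteq> 0" using of_nat_neq_0[of N, where 'a = complex] by (simp add: add.commute)
  have "1 / (of_nat N + 1) - 1 = - (of_nat N / (of_nat N + 1) :: complex)"
    using N0 by (simp add: field_simps)
  moreover have "1 / 3 * (of_nat N / (of_nat N + 1)) * (\<Sum>j = 0..2. ?E j - 1)
      = 1 / 3 * (of_nat N / (of_nat N + 1)) * (\<Sum>j = 0..2. ?E j) - of_nat N / (of_nat N + 1)"
  proof -
    have "1 / 3 * q * (S - 3) = 1 / 3 * q * S - q" for q S :: complex by (simp add: right_diff_distrib)
    moreover have "(\<Sum>j = 0..2. ?E j - 1) = (\<Sum>j = 0..2. ?E j) - 3" by (simp add: sum_subtractf)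
    ultimately show ?thesis by presburger
  qed
  moreover have "x + a - 1 = b" if "x - 1 = - q" "b = a - q" for a b q x :: complex
  proof -
    have "x + a - 1 = (x - 1) + a" by simp
    then show ?thesis using that by simp
  qed
  ultimately have "local_factor N \<theta> - 1 = 1 / 3 * (of_nat N / (of_nat N + 1)) * (\<Sum>j = 0..2. ?E j - 1)"
    unfolding local_factor_def by presburger
  also have "norm \<dots> = N / (N + 1) * (norm (\<Sum>j = 0..2. ?E j - 1) / 3)"
  proof -
    have N1: "norm (of_nat N + 1 :: complex) = real N + 1"
      using norm_of_nat[of "N + 1", where 'a = complex] by (simp add: add.commute)
    show ?thesis by (simp only: norm_mult norm_divide norm_one norm_numeral norm_of_nat N1) simp
  qed
  also have "\<dots> \<le> 1 * (norm (\<Sum>j = 0..2. ?E j - 1) / 3)"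
    by (intro mult_right_mono) auto
  finally have 1: "norm (local_factor N \<theta> - 1) \<le> norm (\<Sum>j = 0..2. ?E j - 1) / 3" by simp
  have rot: "Re u + Re (\<zeta>\<^sub>3 * u) + Re (\<zeta>\<^sub>3\<^sup>2 * u) = 0"
  proof -
    have "u + \<zeta>\<^sub>3 * u + \<zeta>\<^sub>3\<^sup>2 * u = 0"
      by (simp add: power2_eq_square zeta3_square algebra_simps)
    from arg_cong[OF this, of Re] show ?thesis by simp
  qed
  have "{0..2::nat} = {0,1,2}" by auto
  then have "(\<Sum>j = 0..2. \<theta> j) = (\<Sum>j = 0..2. e j)"
    using rot by (simp add: e_def)
  then have i: "\<i> * of_real (\<Sum>j = 0..2. e j) = (\<Sum>j = 0..2. \<i> * of_real (\<theta> j))"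
    by (metis of_real_sum sum_distrib_left)
  have "(\<Sum>j = 0..2. ?E j - 1) = (\<Sum>j = 0..2. ?E j - (1 - \<i> * of_real (\<theta> j))) - \<i> * of_real (\<Sum>j = 0..2. e j)"
    unfolding i by (simp add: sum_subtractf sum.distrib)
  also have "norm \<dots> \<le> norm (\<Sum>j = 0..2. ?E j - (1 - \<i> * of_real (\<theta> j))) + \<bar>\<Sum>j = 0..2. e j\<bar>"
    by (intro order.trans[OF norm_triangle_ineq4]) (simp add: norm_mult del: of_real_sum)
  also have "\<dots> \<le> (\<Sum>j = 0..2::nat. 25 * R\<^sup>2) + (\<Sum>j = 0..2::nat. 4 * R * q)"
  proof (intro add_mono sum_norm_le order.trans[OF sum_abs] sum_mono)
    fix j :: nat
    have "norm (?E j - (\<Sum>k\<le>1. (- \<i> * of_real (\<theta> j)) ^ k / fact k))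
        \<le> exp \<bar>Re (- \<i> * of_real (\<theta> j))\<bar> * norm (- \<i> * of_real (\<theta> j)) ^ Suc 1 / fact 1"
      by (rule Taylor_exp)
    then have "norm (?E j - (1 - \<i> * of_real (\<theta> j))) \<le> \<bar>\<theta> j\<bar>\<^sup>2"
      by (simp add: norm_mult power2_eq_square)
    also have "\<bar>\<theta> j\<bar> \<le> 5 * R"
    proof -
      have "\<bar>Re (\<zeta>\<^sub>3 ^ j * u)\<bar> \<le> norm (\<zeta>\<^sub>3 ^ j * u)" by (rule abs_Re_le_cmod)
      then have "\<bar>Re (\<zeta>\<^sub>3 ^ j * u)\<bar> \<le> R" by (simp add: norm_mult norm_power u)
      moreover have "4 * R * q \<le> 4 * R" using q R0 by (simp add: mult_left_le)
      ultimately show ?thesis using u(2)[of j] by linarith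
    qed
    then have "\<bar>\<theta> j\<bar>\<^sup>2 \<le> (5 * R)\<^sup>2" by (intro power_mono) auto
    finally show "norm (?E j - (1 - \<i> * of_real (\<theta> j))) \<le> 25 * R\<^sup>2" by (simp add: power_mult_distrib)
  qed (use u(2) in \<open>simp add: e_def\<close>)
  finally show ?thesis using 1 by simp
qed

text \<open>With y = |x| / 2 \<le> 1, sin y \<ge> 5y/6 by Taylor, and cos x = 1 - 2 (sin y)^2 gives
  the coefficient 25/72, which exceeds 1/3.\<close>

lemma cos_le_quadratic:
  assumes "\<bar>x\<bar> \<le> 2"
  shows "cos x \<le> 1 - x\<^sup>2 / (3::real)"
proof -
  define y where "y = \<bar>x\<bar> / 2"
  have y: "0 \<le> y" "y \<le> 1" using assms by (auto simp: y_def)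
  have "\<bar>sin y - (\<Sum>m<3. sin_coeff m * y ^ m)\<bar> \<le> inverse (fact 3) * \<bar>y\<bar> ^ 3"
    by (rule Maclaurin_sin_bound)
  then have "\<bar>sin y - y\<bar> \<le> y ^ 3 / 6"
    using y by (simp add: eval_nat_numeral sin_coeff_def field_simps)
  moreover have "y ^ 3 \<le> y" using y power_decreasing[of 1 3 y] by simp
  ultimately have "sin y \<ge> 5 / 6 * y" by linarith
  then have "(5 / 6 * y)\<^sup>2 \<le> (sin y)\<^sup>2" using y by (intro power_mono) auto
  moreover have "cos x = 1 - 2 * (sin y)\<^sup>2"
    using cos_double_sin[of y] by (simp add: y_def)
  moreover have "x\<^sup>2 = 4 * y\<^sup>2" by (simp add: y_def power_divide)
  moreover have "(5 / 6 * y)\<^sup>2 = 25 / 36 * y\<^sup>2" by (simp add: power_mult_distrib power_divide)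
  ultimately show ?thesis using zero_le_power2[of y] by linarith
qed

lemma norm_sum_3_exp_square:
  fixes \<theta> :: "nat \<Rightarrow> real"
  shows "(norm (\<Sum>j = 0..2. exp (- \<i> * of_real (\<theta> j))))\<^sup>2
    = 3 + 2 * (cos (\<theta> 0 - \<theta> 1) + cos (\<theta> 0 - \<theta> 2) + cos (\<theta> 1 - \<theta> 2))"
proof -
  have "{0..2::nat} = {0,1,2}" by auto
  then have "(norm (\<Sum>j = 0..2. exp (- \<i> * of_real (\<theta> j))))\<^sup>2
      = (cos (\<theta> 0) + cos (\<theta> 1) + cos (\<theta> 2))\<^sup>2 + (sin (\<theta> 0) + sin (\<theta> 1) + sin (\<theta> 2))\<^sup>2"
    by (simp add: cmod_power2 Re_exp Im_exp) (simp add: power2_eq_square algebra_simps)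
  also have "\<dots> = ((sin (\<theta> 0))\<^sup>2 + (cos (\<theta> 0))\<^sup>2) + ((sin (\<theta> 1))\<^sup>2 + (cos (\<theta> 1))\<^sup>2)
      + ((sin (\<theta> 2))\<^sup>2 + (cos (\<theta> 2))\<^sup>2)
      + 2 * (cos (\<theta> 0 - \<theta> 1) + cos (\<theta> 0 - \<theta> 2) + cos (\<theta> 1 - \<theta> 2))"
    unfolding cos_diff by (simp add: power2_eq_square algebra_simps)
  finally show ?thesis by simp
qed

text \<open>The squared differences of the real parts of the three rotations add up to 9/2 R^2,
  whatever the direction of u. The bound on q keeps each error below R/10, so at least 2R^2 survives
  for the phases. Then |S|^2 \<le> 9 - 4/3 R^2, hence |S| / 3 \<le> 1 - 2/27 R^2, and N / (N + 1)
  \<ge> 1/2 leaves 1/27.\<close>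

lemma norm_local_factor_decay:
  assumes \<theta>: "near_rotations \<theta> R q" and q: "0 \<le> q" "q \<le> 1 / 40" and R: "R \<le> 1 / 2" and N: "N \<ge> 1"
  shows "norm (local_factor N \<theta>) \<le> exp (- R\<^sup>2 / 27)"
proof -
  obtain u where u: "norm u = R" "\<And>j. \<bar>\<theta> j - Re (\<zeta>\<^sub>3 ^ j * u)\<bar> \<le> 4 * R * q"
    using \<theta> by (auto simp: near_rotations_def)
  have R0: "R \<ge> 0" using u by auto
  define e where "e j = \<theta> j - Re (\<zeta>\<^sub>3 ^ j * u)" for j
  let ?S = "\<Sum>j = 0..2. exp (- \<i> * of_real (\<theta> j))"
  have "4 * R * q \<le> R / 10" using q R0 mult_left_mono[of q "1/40" "4 * R"] by simp
  then have e: "\<bar>e j\<bar> \<le> R / 10" for j using u(2)[of j] by (simp add: e_def)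
  define D where "D j k = Re (\<zeta>\<^sub>3 ^ j * u) - Re (\<zeta>\<^sub>3 ^ k * u)" for j k
  have diff: "\<bar>\<theta> j - \<theta> k\<bar> \<le> 2" "(D j k)\<^sup>2 / 2 - R\<^sup>2 / 25 \<le> (\<theta> j - \<theta> k)\<^sup>2" for j k
  proof -
    have "\<bar>Re (\<zeta>\<^sub>3 ^ i * u)\<bar> \<le> R" for i
      using abs_Re_le_cmod[of "\<zeta>\<^sub>3 ^ i * u"] by (simp add: norm_mult norm_power u)
    from this[of j] this[of k] e[of j] e[of k] R R0 show "\<bar>\<theta> j - \<theta> k\<bar> \<le> 2"
      unfolding e_def by linarith
    have "\<bar>e j - e k\<bar> \<le> R / 5" using e[of j] e[of k] by linarith
    then have "\<bar>e j - e k\<bar>\<^sup>2 \<le> (R / 5)\<^sup>2" by (intro power_mono) auto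
    then have ee: "(e j - e k)\<^sup>2 \<le> R\<^sup>2 / 25" by (simp add: power_divide)
    have eq: "\<theta> j - \<theta> k = D j k + (e j - e k)" by (simp add: D_def e_def)
    \<comment> \<open>Half of this square is exactly (D + d)^2 - D^2 / 2 + d^2 with d the difference
      of the errors.\<close>
    have "0 \<le> (D j k + 2 * (e j - e k))\<^sup>2" by simp
    then show "(D j k)\<^sup>2 / 2 - R\<^sup>2 / 25 \<le> (\<theta> j - \<theta> k)\<^sup>2"
      using ee unfolding eq by (simp add: power2_eq_square algebra_simps)
  qed
  have "(D 0 1)\<^sup>2 + (D 0 2)\<^sup>2 + (D 1 2)\<^sup>2 = 9 / 2 * R\<^sup>2"
  proof -
    note z = zeta3_eq
    have z2: "\<zeta>\<^sub>3\<^sup>2 = Complex (- 1 / 2) (- sqrt 3 / 2)"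
      unfolding power2_eq_square zeta3_square by (simp add: z complex_eq_iff)
    define s where "s = sqrt 3 * Im u"
    have s: "s\<^sup>2 = 3 * (Im u)\<^sup>2" by (simp add: s_def power_mult_distrib)
    have "D 0 1 = 3 / 2 * Re u + s / 2" "D 0 2 = 3 / 2 * Re u - s / 2" "D 1 2 = - s"
      by (simp_all add: D_def z2) (simp_all add: z s_def field_simps)
    then have "(D 0 1)\<^sup>2 + (D 0 2)\<^sup>2 + (D 1 2)\<^sup>2 = 9 / 2 * (Re u)\<^sup>2 + 3 / 2 * s\<^sup>2"
      by (simp only:) (simp add: power2_eq_square algebra_simps)
    also have "\<dots> = 9 / 2 * ((Re u)\<^sup>2 + (Im u)\<^sup>2)" by (simp add: s)
    also have "(Re u)\<^sup>2 + (Im u)\<^sup>2 = R\<^sup>2" using u(1) by (metis cmod_power2)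
    finally show ?thesis .
  qed
  then have sq: "2 * R\<^sup>2 \<le> (\<theta> 0 - \<theta> 1)\<^sup>2 + (\<theta> 0 - \<theta> 2)\<^sup>2 + (\<theta> 1 - \<theta> 2)\<^sup>2"
    using diff(2)[of 0 1] diff(2)[of 0 2] diff(2)[of 1 2] zero_le_power2[of R] by linarith
  have "(norm ?S)\<^sup>2 \<le> 9 - 4 / 3 * R\<^sup>2"
  proof -
    have arith: "3 + 2 * (c1 + c2 + c3) \<le> 9 - 4 / 3 * w"
      if "2 * w \<le> d1 + d2 + d3" "c1 \<le> 1 - d1 / 3" "c2 \<le> 1 - d2 / 3" "c3 \<le> 1 - d3 / 3"
      for c1 c2 c3 d1 d2 d3 w :: real using that by argo
    show ?thesis
      unfolding norm_sum_3_exp_square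
      by (rule arith[OF sq]) (intro cos_le_quadratic diff(1))+
  qed
  also have "\<dots> \<le> (3 - 2 / 9 * R\<^sup>2)\<^sup>2"
    by (simp add: power2_diff power_mult_distrib power_divide)
  finally have S: "norm ?S \<le> 3 - 2 / 9 * R\<^sup>2"
  proof (rule power2_le_imp_le)
    have "R\<^sup>2 \<le> (1 / 2)\<^sup>2" using R R0 by (intro power_mono)
    then show "0 \<le> 3 - 2 / 9 * R\<^sup>2" by (simp add: power_divide)
  qed
  have "norm (local_factor N \<theta>) \<le> 1 / (real N + 1) + real N / (real N + 1) * (norm ?S / 3)"
    by (rule norm_local_factor_le)
  also have "\<dots> \<le> 1 / (real N + 1) + real N / (real N + 1) * (1 - 2 / 27 * R\<^sup>2)"
    using S by (intro add_left_mono mult_left_mono) auto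
  also have "\<dots> = 1 - real N / (real N + 1) * (2 / 27 * R\<^sup>2)"
  proof -
    have "1 / (real N + 1) + real N / (real N + 1) = 1" by (simp add: add_divide_distrib[symmetric])
    then show ?thesis unfolding right_diff_distrib mult_1_right by linarith
  qed
  also have "\<dots> \<le> 1 - 1 / 2 * (2 / 27 * R\<^sup>2)"
    using N by (intro diff_left_mono mult_right_mono) (auto simp: field_simps)
  also have "\<dots> \<le> exp (- R\<^sup>2 / 27)"
    using exp_ge_add_one_self[of "- R\<^sup>2 / 27"] by simp
  finally show ?thesis .
qed

section \<open>The phases of the two cases\<close>

lemma near_rotationsI:
  assumes "\<And>j. norm (w j - \<zeta>\<^sub>3 ^ j * v) \<le> 4 * norm v * q"
  shows "near_rotations (\<lambda>j. Re (c * w j)) (norm c * norm v) q"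
  unfolding near_rotations_def
proof (intro exI[of _ "c * v"] conjI allI)
  fix j
  have "\<bar>Re (c * w j) - Re (\<zeta>\<^sub>3 ^ j * (c * v))\<bar> = \<bar>Re (c * (w j - \<zeta>\<^sub>3 ^ j * v))\<bar>"
    by (simp add: algebra_simps)
  also have "\<dots> \<le> norm c * norm (w j - \<zeta>\<^sub>3 ^ j * v)"
    using abs_Re_le_cmod[of "c * (w j - \<zeta>\<^sub>3 ^ j * v)"] by (simp add: norm_mult)
  also have "\<dots> \<le> norm c * (4 * norm v * q)" by (intro mult_left_mono assms) auto
  finally show "\<bar>Re (c * w j) - Re (\<zeta>\<^sub>3 ^ j * (c * v))\<bar> \<le> 4 * (norm c * norm v) * q"
    by (simp add: algebra_simps)
qed (simp add: norm_mult)

lemma norm_nat_powr_complex: "norm (of_nat N powr s :: complex) = real N powr Re s"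
  using norm_powr_real_powr[of "of_nat N" s] by simp

text \<open>The worst case is 1 / sqrt 2 < 3/4. The resulting bound 1 / (1 - q) \<le> 4 is the
  source of the 4 in \<open>near_rotations\<close>.\<close>

lemma nat_powr_minus_le:
  assumes "N \<ge> 2" "\<sigma> > 1 / 2"
  shows "real N powr - \<sigma> \<le> 3 / 4"
proof -
  have "real N powr - \<sigma> \<le> 2 powr - \<sigma>" using assms by (intro powr_mono2') auto
  also have "\<dots> \<le> 2 powr - (1 / 2)" using assms by (intro powr_mono) auto
  also have "\<dots> = 1 / sqrt 2" by (simp add: powr_minus powr_half_sqrt inverse_eq_divide)
  also have "\<dots> \<le> 3 / 4"
    using real_le_rsqrt[of "4 / 3" 2] by (simp add: field_simps power_divide)
  finally show ?thesis .
qed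

definition phase1 :: "complex \<Rightarrow> complex \<Rightarrow> nat \<Rightarrow> nat \<Rightarrow> real" where
  "phase1 s y N j = Re (cnj y * Ln (1 - \<zeta>\<^sub>3 ^ j / of_nat N powr s))"

definition phase2 :: "complex \<Rightarrow> complex \<Rightarrow> nat \<Rightarrow> nat \<Rightarrow> real" where
  "phase2 s y N j = Re (cnj y * \<zeta>\<^sub>3 ^ j * Ln (of_nat N) / (of_nat N powr s - \<zeta>\<^sub>3 ^ j))"

text \<open>To first order Ln (1 - w) is -w, here with w equal to N^-s times a cube root of
  unity.\<close>

lemma near_rotations_phase1:
  assumes N: "N \<ge> 2" and s: "Re s > 1 / 2"
  shows "near_rotations (phase1 s y N) (norm y * real N powr - Re s) (real N powr - Re s)"
proof -
  define z where "z = (of_nat N powr (- s) :: complex)"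
  have z: "norm z = real N powr - Re s" "norm z \<le> 3 / 4"
    using nat_powr_minus_le[OF N s] by (simp_all add: z_def norm_nat_powr_complex)
  have "near_rotations (\<lambda>j. Re (cnj y * Ln (1 - \<zeta>\<^sub>3 ^ j * z))) (norm (cnj y) * norm (- z)) (norm z)"
  proof (rule near_rotationsI)
    fix j
    have nz: "norm (- (\<zeta>\<^sub>3 ^ j * z)) = norm z" by (simp add: norm_mult norm_power)
    have "norm (ln (1 + - (\<zeta>\<^sub>3 ^ j * z)) - - (\<zeta>\<^sub>3 ^ j * z)) \<le> (norm z)\<^sup>2 / (1 - norm z)"
      using Ln_approx_linear[of "- (\<zeta>\<^sub>3 ^ j * z)"] z(2) unfolding nz by linarith
    also have "\<dots> \<le> (norm z)\<^sup>2 / (1 / 4)" using z(2) by (intro divide_left_mono) auto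
    finally show "norm (Ln (1 - \<zeta>\<^sub>3 ^ j * z) - \<zeta>\<^sub>3 ^ j * - z) \<le> 4 * norm (- z) * norm z"
      by (simp add: power2_eq_square)
  qed
  moreover have "(\<lambda>j. Re (cnj y * Ln (1 - \<zeta>\<^sub>3 ^ j * z))) = phase1 s y N"
    by (simp add: fun_eq_iff phase1_def z_def powr_minus divide_inverse)
  ultimately show ?thesis by (simp add: z)
qed

text \<open>With the same w, the fraction equals w / (1 - w) = w + w^2 / (1 - w).\<close>

lemma near_rotations_phase2:
  assumes N: "N \<ge> 2" and s: "Re s > 1 / 2"
  shows "near_rotations (phase2 s y N) (norm y * ln N * real N powr - Re s) (real N powr - Re s)"
proof -
  define z where "z = (of_nat N powr (- s) :: complex)"
  have z: "norm z = real N powr - Re s" "norm z \<le> 3 / 4" "z \<noteq> 0"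
    using nat_powr_minus_le[OF N s] N by (simp_all add: z_def norm_nat_powr_complex)
  define L where "L = (Ln (of_nat N) :: complex)"
  have L: "norm L = ln N" using N by (simp add: L_def Ln_of_nat)
  have "near_rotations (\<lambda>j. Re (cnj y * (L * (\<zeta>\<^sub>3 ^ j / (1 / z - \<zeta>\<^sub>3 ^ j))))) (norm (cnj y) * norm (L * z)) (norm z)"
  proof (rule near_rotationsI)
    fix j
    define w where "w = \<zeta>\<^sub>3 ^ j * z"
    have w: "norm w = norm z" by (simp add: w_def norm_mult norm_power)
    have w1: "norm (1 - w) \<ge> 1 / 4"
      using norm_triangle_ineq2[of 1 w] w z(2) by simp
    then have "1 - w \<noteq> 0" by auto
    then have "\<zeta>\<^sub>3 ^ j / (1 / z - \<zeta>\<^sub>3 ^ j) - w = w\<^sup>2 / (1 - w)"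
      using z(3) by (simp add: w_def field_simps power2_eq_square)
    then have "L * (\<zeta>\<^sub>3 ^ j / (1 / z - \<zeta>\<^sub>3 ^ j)) - \<zeta>\<^sub>3 ^ j * (L * z) = L * (w\<^sup>2 / (1 - w))"
      unfolding w_def by (metis mult.left_commute right_diff_distrib)
    also have "norm \<dots> = norm L * ((norm z)\<^sup>2 / norm (1 - w))"
      by (simp add: norm_mult norm_divide norm_power w)
    also have "\<dots> \<le> norm L * ((norm z)\<^sup>2 / (1 / 4))"
      using w1 by (intro mult_left_mono divide_left_mono mult_pos_pos) auto
    finally show "norm (L * (\<zeta>\<^sub>3 ^ j / (1 / z - \<zeta>\<^sub>3 ^ j)) - \<zeta>\<^sub>3 ^ j * (L * z)) \<le> 4 * norm (L * z) * norm z"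
      by (simp add: power2_eq_square norm_mult mult.assoc)
  qed
  moreover have "(\<lambda>j. Re (cnj y * (L * (\<zeta>\<^sub>3 ^ j / (1 / z - \<zeta>\<^sub>3 ^ j))))) = phase2 s y N"
    by (simp add: fun_eq_iff phase2_def z_def L_def powr_minus mult_ac inverse_eq_divide)
  ultimately show ?thesis by (simp add: z L norm_mult mult.assoc)
qed

subsection \<open>Decay of the product\<close>

lemma one_plus_ln_le_powr:
  fixes x \<delta> :: real
  assumes "x \<ge> 1" "\<delta> > 0"
  shows "1 + ln x \<le> (1 + 1 / \<delta>) * x powr \<delta>"
proof -
  have "\<delta> * ln x \<le> x powr \<delta>"
    using ln_le_minus_one[of "x powr \<delta>"] assms by (simp add: ln_powr)
  then have "ln x \<le> 1 / \<delta> * x powr \<delta>" using assms by (simp add: field_simps)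
  moreover have "1 \<le> x powr \<delta>" using assms by (simp add: ge_one_powr_ge_zero)
  ultimately show ?thesis by (simp add: distrib_right)
qed

lemma summable_local_factor:
  assumes \<sigma>: "\<sigma> > 1 / 2"
    and \<theta>: "\<And>N. N \<ge> 2 \<Longrightarrow> near_rotations (\<theta> N) (R N) (real N powr - \<sigma>)"
    and R: "\<And>N. N \<ge> 2 \<Longrightarrow> R N \<le> Y * (1 + ln N) * real N powr - \<sigma>" and Y: "Y \<ge> 0"
  shows "(\<lambda>P. norm (local_factor (ideal_norm P) (\<theta> (ideal_norm P)) - 1)) summable_on primes_not_dvd_3"
proof -
  \<comment> \<open>The logarithm is absorbed into N^\<delta>. This choice turns R^2 into the power
    of N with exponent 2\<delta> - 2\<sigma> = -(\<sigma> + 1/2), which is below -1.\<close>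
  define \<delta> where "\<delta> = (\<sigma> - 1 / 2) / 2"
  define K where "K = Y * (1 + 1 / \<delta>)"
  have \<delta>: "\<delta> > 0" using \<sigma> by (simp add: \<delta>_def)
  have K: "K \<ge> 0" using Y \<delta> by (simp add: K_def)
  show ?thesis
  proof (rule Infinite_Sum.abs_summable_on_comparison_test')
    show "(\<lambda>P. (25 * K\<^sup>2 + 4 * K) * real (ideal_norm P) powr - (\<sigma> + 1 / 2)) summable_on primes_not_dvd_3"
      using \<sigma> by (intro summable_on_cmult_right summable_ideal_norm_powr) auto
  next
    fix P assume "P \<in> primes_not_dvd_3"
    define N where "N = ideal_norm P"
    have N: "N \<ge> 2" unfolding N_def by (rule ideal_norm_ge_2) fact
    define q where "q = real N powr - \<sigma>"
    have q: "0 \<le> q" "q \<le> 1" using nat_powr_minus_le[OF N \<sigma>] by (simp_all add: q_def)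
    have R0: "R N \<ge> 0" using \<theta>[OF N] norm_ge_zero unfolding near_rotations_def by metis
    have "R N \<le> Y * (1 + ln N) * q" using R[OF N] by (simp add: q_def)
    also have "\<dots> \<le> Y * ((1 + 1 / \<delta>) * real N powr \<delta>) * q"
      using one_plus_ln_le_powr[of "real N" \<delta>] N \<delta> Y q by (intro mult_right_mono mult_left_mono) auto
    also have "\<dots> = K * real N powr (\<delta> - \<sigma>)"
      using powr_add[of "real N" \<delta> "- \<sigma>"] by (simp add: K_def q_def)
    finally have RN: "R N \<le> K * real N powr (\<delta> - \<sigma>)" .
    have "norm (local_factor N (\<theta> N) - 1) \<le> 25 * (R N)\<^sup>2 + 4 * R N * q"
      using norm_local_factor_diff_1_le[OF \<theta>[OF N]] q by (simp add: q_def)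
    also have "\<dots> \<le> 25 * (K * real N powr (\<delta> - \<sigma>))\<^sup>2 + 4 * (K * real N powr (\<delta> - \<sigma>)) * q"
      using RN R0 q K by (intro add_mono mult_left_mono mult_right_mono power_mono) auto
    also have "(K * real N powr (\<delta> - \<sigma>))\<^sup>2 = K\<^sup>2 * real N powr - (\<sigma> + 1 / 2)"
    proof -
      have "(\<delta> - \<sigma>) + (\<delta> - \<sigma>) = - (\<sigma> + 1 / 2)" by (simp add: \<delta>_def field_simps)
      then show ?thesis by (simp add: power_mult_distrib power2_eq_square flip: powr_add)
    qed
    also have "4 * (K * real N powr (\<delta> - \<sigma>)) * q = 4 * K * real N powr (\<delta> - 2 * \<sigma>)"
      using powr_add[of "real N" "\<delta> - \<sigma>" "- \<sigma>"] by (simp add: q_def)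
    also have "\<dots> \<le> 4 * K * real N powr - (\<sigma> + 1 / 2)"
      using N K \<sigma> by (intro mult_left_mono powr_mono) (auto simp: \<delta>_def field_simps)
    finally have "norm (local_factor N (\<theta> N) - 1) \<le> (25 * K\<^sup>2 + 4 * K) * real N powr - (\<sigma> + 1 / 2)"
      by (simp add: algebra_simps)
    then show "norm (local_factor (ideal_norm P) (\<theta> (ideal_norm P)) - 1)
        \<le> (25 * K\<^sup>2 + 4 * K) * real (ideal_norm P) powr - (\<sigma> + 1 / 2)"
      by (simp add: N_def)
  qed
qed

text \<open>The bound with \<open>Y\<close> serves convergence, and \<open>1 + ln N\<close>
  dominates both 1 and \<open>ln N\<close>, so it covers both cases. The conditions on
  \<open>W\<close> and \<open>r\<close> serve the decay; one ideal of norm p is chosen for each p in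
  \<open>W\<close>.\<close>

lemma norm_infprod_local_factor_le:
  assumes \<sigma>: "\<sigma> > 1 / 2"
    and \<theta>: "\<And>N. N \<ge> 2 \<Longrightarrow> near_rotations (\<theta> N) (R N) (real N powr - \<sigma>)"
    and R: "\<And>N. N \<ge> 2 \<Longrightarrow> R N \<le> Y * (1 + ln N) * real N powr - \<sigma>" and Y: "Y \<ge> 0"
    and W: "finite W" "\<And>p. p \<in> W \<Longrightarrow> prime p \<and> p mod 3 = 1"
    and RW: "\<And>p. p \<in> W \<Longrightarrow> r \<le> R p \<and> R p \<le> 1 / 2 \<and> real p powr - \<sigma> \<le> 1 / 40" and r: "r \<ge> 0"
  shows "norm (infprod (\<lambda>P. local_factor (ideal_norm P) (\<theta> (ideal_norm P))) primes_not_dvd_3)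
    \<le> exp (- (r\<^sup>2 / 27 * real (card W)))"
proof -
  have "\<forall>p\<in>W. \<exists>P. P \<in> primes_not_dvd_3 \<and> ideal_norm P = p"
    using prime_ideal_of_norm W(2) by metis
  then obtain Q where Q: "\<And>p. p \<in> W \<Longrightarrow> Q p \<in> primes_not_dvd_3 \<and> ideal_norm (Q p) = p" by metis
  have inj: "inj_on Q W" using Q by (metis inj_onI)
  have "norm (infprod (\<lambda>P. local_factor (ideal_norm P) (\<theta> (ideal_norm P))) primes_not_dvd_3)
      \<le> (\<Prod>P\<in>Q ` W. norm (local_factor (ideal_norm P) (\<theta> (ideal_norm P))))"
    using W(1) Q
    by (intro norm_infprod_le summable_local_factor[OF \<sigma> \<theta> R Y] norm_local_factor_le_1) auto
  also have "\<dots> = (\<Prod>p\<in>W. norm (local_factor p (\<theta> p)))"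
    using Q by (simp add: prod.reindex[OF inj])
  also have "\<dots> \<le> (\<Prod>p\<in>W. exp (- (r\<^sup>2 / 27)))"
  proof (intro prod_mono conjI)
    fix p assume p: "p \<in> W"
    then have "p \<ge> 2" using W(2) prime_ge_2_nat by blast
    then have "norm (local_factor p (\<theta> p)) \<le> exp (- (R p)\<^sup>2 / 27)"
      using RW[OF p] by (intro norm_local_factor_decay[OF \<theta>]) auto
    also have "\<dots> \<le> exp (- (r\<^sup>2 / 27))"
      using RW[OF p] r power_mono[of r "R p" 2] by simp
    finally show "norm (local_factor p (\<theta> p)) \<le> exp (- (r\<^sup>2 / 27))" .
  qed auto
  also have "\<dots> = exp (- (r\<^sup>2 / 27 * real (card W)))"
    by (simp flip: exp_of_nat_mult add: mult.commute)
  finally show ?thesis .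
qed

section \<open>The bounds in the two cases\<close>

lemma M_case1_eq:
  "M_case1 s (Re y) (Im y) = exp (- \<i> * of_real (Re (cnj y * Ln (1 - 3 powr (- s))))) *
    infprod (\<lambda>P. local_factor (ideal_norm P) (phase1 s y (ideal_norm P))) primes_not_dvd_3"
  by (simp add: M_case1_def Let_def local_factor_def phase1_def)

lemma M_case2_eq:
  "M_case2 s (Re y) (Im y) = exp (- \<i> * of_real (Re (cnj y * Ln 3 / (3 powr s - 1)))) *
    infprod (\<lambda>P. local_factor (ideal_norm P) (phase2 s y (ideal_norm P))) primes_not_dvd_3"
  by (simp add: M_case2_def Let_def local_factor_def phase2_def)

lemma norm_M_case1:
  "norm (M_case1 s (Re y) (Im y))
    = norm (infprod (\<lambda>P. local_factor (ideal_norm P) (phase1 s y (ideal_norm P))) primes_not_dvd_3)"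
  by (simp only: M_case1_eq norm_mult) simp

lemma norm_M_case2:
  "norm (M_case2 s (Re y) (Im y))
    = norm (infprod (\<lambda>P. local_factor (ideal_norm P) (phase2 s y (ideal_norm P))) primes_not_dvd_3)"
  by (simp only: M_case2_eq norm_mult) simp

lemma powr_minus_prime_window:
  assumes "p \<in> prime_window B X" "X > 0" "B \<ge> 1" "\<sigma> > 0"
  shows "real p powr - \<sigma> \<le> X powr - \<sigma>" "B powr - \<sigma> * X powr - \<sigma> \<le> real p powr - \<sigma>"
proof -
  show "real p powr - \<sigma> \<le> X powr - \<sigma>"
    using assms by (intro powr_mono2') (auto simp: prime_window_def)
  have "(B * X) powr - \<sigma> \<le> real p powr - \<sigma>"
    using assms by (intro powr_mono2') (auto simp: prime_window_def)
  then show "B powr - \<sigma> * X powr - \<sigma> \<le> real p powr - \<sigma>" using assms by (simp add: powr_mult)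
qed

lemma M_case1_bound:
  assumes \<sigma>: "\<sigma> > 1 / 2" and B: "B \<ge> 1"
    and win: "\<And>X. X \<ge> 1 \<Longrightarrow> X \<le> real (card (prime_window B X)) * ln (B * X)"
    and s: "Re s = \<sigma>" and t: "ln (cmod y) \<ge> \<sigma> * ln B + ln 2" "ln (cmod y) \<ge> ln 20"
  shows "norm (M_case1 s (Re y) (Im y))
    \<le> exp (- ((B powr - \<sigma> / 2)\<^sup>2 / 27 * (\<sigma> / 2)) * cmod y powr (1 / \<sigma>) * inverse (ln (cmod y)))"
proof -
  define t where "t = cmod y"
  have lt: "ln t > 0" using t(2) ln_gt_zero[of "20::real"] unfolding t_def by linarith
  then have "t \<noteq> 0" by auto
  then have t0: "t > 0" by (simp add: t_def)
  have t20: "t \<ge> 20" using t(2) t0 by (simp add: t_def)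
  define X where "X = (2 * t) powr (1 / \<sigma>)"
  define W where "W = prime_window B X"
  define r where "r = B powr - \<sigma> / 2"
  have X1: "X \<ge> 1" using t20 \<sigma> by (simp add: X_def ge_one_powr_ge_zero)
  have Xs: "X powr - \<sigma> = 1 / (2 * t)"
    using \<sigma> t20 by (simp add: X_def powr_powr powr_minus inverse_eq_divide)
  have "norm (M_case1 s (Re y) (Im y)) \<le> exp (- (r\<^sup>2 / 27 * real (card W)))"
    unfolding norm_M_case1
  proof (rule norm_infprod_local_factor_le[OF \<sigma>])
    show "near_rotations (phase1 s y N) (t * real N powr - \<sigma>) (real N powr - \<sigma>)" if "N \<ge> 2" for N
      using near_rotations_phase1[OF that, of s y] \<sigma> s by (simp add: t_def)
    show "t * real N powr - \<sigma> \<le> t * (1 + ln N) * real N powr - \<sigma>" if "N \<ge> 2" for N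
      using that t0 by (intro mult_right_mono) (auto simp: mult_le_cancel_left1)
    show "prime p \<and> p mod 3 = 1" if "p \<in> W" for p using that by (simp add: W_def prime_window_def)
    fix p assume p: "p \<in> W"
    then have "p \<in> prime_window B X" by (simp add: W_def)
    note pw = powr_minus_prime_window[OF this _ B, of \<sigma>]
    have p1: "real p powr - \<sigma> \<le> 1 / (2 * t)" and p2: "B powr - \<sigma> * (1 / (2 * t)) \<le> real p powr - \<sigma>"
      using pw X1 \<sigma> unfolding Xs by auto
    have "t * real p powr - \<sigma> \<le> t * (1 / (2 * t))" using p1 t0 by (intro mult_left_mono) auto
    moreover have "t * (B powr - \<sigma> * (1 / (2 * t))) \<le> t * real p powr - \<sigma>"
      using p2 t0 by (intro mult_left_mono) auto
    moreover have "1 / (2 * t) \<le> 1 / 40" using t20 by (intro divide_left_mono) auto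
    then have "real p powr - \<sigma> \<le> 1 / 40" using p1 by linarith
    ultimately show "r \<le> t * real p powr - \<sigma> \<and> t * real p powr - \<sigma> \<le> 1 / 2 \<and> real p powr - \<sigma> \<le> 1 / 40"
      using t0 by (simp add: r_def)
  qed (use t0 in \<open>auto simp: W_def finite_prime_window r_def\<close>)
  also have "\<dots> \<le> exp (- (r\<^sup>2 / 27 * ((\<sigma> / 2) * t powr (1 / \<sigma>) * inverse (ln t))))"
  proof -
    have "ln (B * X) = ln B + 1 / \<sigma> * (ln 2 + ln t)"
      using B X1 t0 by (simp add: ln_mult X_def ln_powr)
    also have "\<dots> = (\<sigma> * ln B + ln 2 + ln t) / \<sigma>" using \<sigma> by (simp add: field_simps)
    also have "\<dots> \<le> (2 * ln t) / \<sigma>"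
      using t(1) \<sigma> by (intro divide_right_mono) (auto simp: t_def)
    also have "\<dots> = 2 / \<sigma> * ln t" by simp
    finally have L: "ln (B * X) \<le> 2 / \<sigma> * ln t" .
    have "t powr (1 / \<sigma>) \<le> X" unfolding X_def using t0 \<sigma> by (intro powr_mono2) auto
    also have "X \<le> card W * ln (B * X)" using win[OF X1] by (simp add: W_def)
    also have "\<dots> \<le> card W * (2 / \<sigma> * ln t)" using L by (intro mult_left_mono) auto
    finally have "(\<sigma> / 2) * t powr (1 / \<sigma>) * inverse (ln t) \<le> card W"
      using lt \<sigma> by (simp add: field_simps)
    then show ?thesis unfolding exp_le_cancel_iff neg_le_iff_le by (rule mult_left_mono) simp
  qed
  finally show ?thesis by (simp add: r_def t_def mult_ac)
qed

lemma M_case2_bound: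
  assumes \<sigma>: "\<sigma> > 1 / 2" and B: "B \<ge> 1"
    and win: "\<And>X. X \<ge> 1 \<Longrightarrow> X \<le> real (card (prime_window B X)) * ln (B * X)"
    and s: "Re s = \<sigma>" and t: "ln (cmod y) \<ge> 2 * (\<sigma> * ln B + ln (4 / \<sigma>))"
      "ln (cmod y) \<ge> ln 20" "ln (cmod y) \<ge> \<sigma>"
  shows "norm (M_case2 s (Re y) (Im y))
    \<le> exp (- ((B powr - \<sigma> / 4)\<^sup>2 / 27 * (\<sigma> / 2 * (4 / \<sigma>) powr (1 / \<sigma>))) * cmod y powr (1 / \<sigma>) *
        ln (cmod y) powr (1 / \<sigma> - 1))"
proof -
  define t where "t = cmod y"
  have lt: "ln t > 0" using t(2) ln_gt_zero[of "20::real"] unfolding t_def by linarith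
  then have "t \<noteq> 0" by auto
  then have t0: "t > 0" by (simp add: t_def)
  have t20: "t \<ge> 20" using t(2) t0 by (simp add: t_def)
  \<comment> \<open>For p in the window, ln p lies between ln t / \<sigma> and twice that. The
    factor 4 / \<sigma> therefore puts R between B^-\<sigma> / 4 and 1/2.\<close>
  define M where "M = 4 / \<sigma> * (t * ln t)"
  have M4: "M \<ge> 4 * t"
    using t(3) t0 \<sigma> by (simp add: M_def t_def field_simps)
  have M0: "M > 0" using M4 t0 by linarith
  define X where "X = M powr (1 / \<sigma>)"
  define W where "W = prime_window B X"
  define r where "r = B powr - \<sigma> / 4"
  have X1: "X \<ge> 1" using M4 t20 \<sigma> by (simp add: X_def ge_one_powr_ge_zero)
  have Xs: "X powr - \<sigma> = 1 / M"
    using \<sigma> M0 by (simp add: X_def powr_powr powr_minus inverse_eq_divide)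
  have lnX: "ln X = 1 / \<sigma> * (ln (4 / \<sigma>) + ln t + ln (ln t))"
  proof -
    have "ln M = ln (4 / \<sigma>) + ln (t * ln t)"
      unfolding M_def using \<sigma> t0 lt by (subst ln_mult) auto
    then show ?thesis using M0 t0 lt by (simp add: X_def ln_mult ln_powr)
  qed
  have lnX_ge: "ln X \<ge> 1 / \<sigma> * ln t"
  proof -
    have "ln t \<le> ln M" using M4 t0 by simp
    moreover have "ln X = 1 / \<sigma> * ln M" using M0 by (simp add: X_def ln_powr)
    ultimately show ?thesis using \<sigma> by (simp add: divide_right_mono)
  qed
  have L: "ln (B * X) \<le> 2 / \<sigma> * ln t"
  proof -
    \<comment> \<open>The iterated logarithm takes up half of ln t; the first threshold on ln t
      leaves the other half for the constants, which gives 2 ln t in total.\<close>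
    have "ln (ln t / 2) \<le> ln t / 2 - 1" using lt by (intro ln_le_minus_one) auto
    then have "ln (ln t) \<le> ln t / 2" using lt ln_2_less_1 by (simp add: ln_div)
    moreover have "ln (B * X) = ln B + ln X" using B X1 by (simp add: ln_mult)
    moreover have "\<sigma> * (ln B + ln X) = \<sigma> * ln B + (ln (4 / \<sigma>) + ln t + ln (ln t))"
      using \<sigma> by (simp add: lnX distrib_left)
    ultimately have "\<sigma> * ln (B * X) \<le> 2 * ln t" using t(1) by (simp add: t_def)
    then show ?thesis using \<sigma> by (simp add: field_simps)
  qed
  have "norm (M_case2 s (Re y) (Im y)) \<le> exp (- (r\<^sup>2 / 27 * real (card W)))"
    unfolding norm_M_case2
  proof (rule norm_infprod_local_factor_le[OF \<sigma>])
    show "near_rotations (phase2 s y N) (t * ln N * real N powr - \<sigma>) (real N powr - \<sigma>)" if "N \<ge> 2" for N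
      using near_rotations_phase2[OF that, of s y] \<sigma> s by (simp add: t_def)
    show "t * ln N * real N powr - \<sigma> \<le> t * (1 + ln N) * real N powr - \<sigma>" if "N \<ge> 2" for N
      using that t0 by (intro mult_right_mono) auto
    show "prime p \<and> p mod 3 = 1" if "p \<in> W" for p using that by (simp add: W_def prime_window_def)
    fix p assume "p \<in> W"
    then have p: "p \<in> prime_window B X" by (simp add: W_def)
    note pw = powr_minus_prime_window[OF this _ B, of \<sigma>]
    have p1: "real p powr - \<sigma> \<le> 1 / M" and p2: "B powr - \<sigma> * (1 / M) \<le> real p powr - \<sigma>"
      using pw X1 \<sigma> unfolding Xs by auto
    have Xp: "X < p" "p \<le> B * X" using p by (auto simp: prime_window_def)
    have lp1: "ln p \<le> 2 / \<sigma> * ln t" using L ln_mono[of p "B * X"] Xp X1 by linarith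
    have lp2: "1 / \<sigma> * ln t \<le> ln p" using lnX_ge ln_mono[of X p] Xp X1 by linarith
    have "t * ln p * real p powr - \<sigma> \<le> t * (2 / \<sigma> * ln t) * (1 / M)"
      using p1 lp1 t0 Xp X1 M0 lt \<sigma> by (intro mult_mono) auto
    also have "\<dots> = 1 / 2" using t0 lt \<sigma> by (simp add: M_def field_simps)
    finally have upper: "t * ln p * real p powr - \<sigma> \<le> 1 / 2" .
    have "r = t * (1 / \<sigma> * ln t) * (B powr - \<sigma> * (1 / M))"
      using t0 lt \<sigma> by (simp add: M_def r_def field_simps)
    also have "\<dots> \<le> t * ln p * real p powr - \<sigma>"
      using p2 lp2 t0 Xp X1 M0 lt \<sigma> by (intro mult_mono) auto
    finally have lower: "r \<le> t * ln p * real p powr - \<sigma>" .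
    have "1 / M \<le> 1 / 40" using M4 t20 by (intro divide_left_mono) auto
    then show "r \<le> t * ln p * real p powr - \<sigma> \<and> t * ln p * real p powr - \<sigma> \<le> 1 / 2 \<and> real p powr - \<sigma> \<le> 1 / 40"
      using p1 upper lower by linarith
  qed (use t0 in \<open>auto simp: W_def finite_prime_window r_def\<close>)
  also have "\<dots> \<le> exp (- (r\<^sup>2 / 27 * (\<sigma> / 2 * (4 / \<sigma>) powr (1 / \<sigma>) * t powr (1 / \<sigma>) * ln t powr (1 / \<sigma> - 1))))"
  proof -
    \<comment> \<open>The count is X divided by a multiple of ln t, which lowers the exponent of ln
      t from 1 / \<sigma> to 1 / \<sigma> - 1.\<close>
    have "(4 / \<sigma>) powr (1 / \<sigma>) * t powr (1 / \<sigma>) * ln t powr (1 / \<sigma>) = X"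
      unfolding X_def M_def using t0 lt \<sigma> by (subst powr_mult | simp)+
    also have "X \<le> card W * ln (B * X)" using win[OF X1] by (simp add: W_def)
    also have "\<dots> \<le> card W * (2 / \<sigma> * ln t)" using L by (intro mult_left_mono) auto
    finally have "\<sigma> / 2 * ((4 / \<sigma>) powr (1 / \<sigma>) * t powr (1 / \<sigma>) * ln t powr (1 / \<sigma>)) / ln t \<le> card W"
      using lt \<sigma> by (simp add: field_simps)
    also have "\<sigma> / 2 * ((4 / \<sigma>) powr (1 / \<sigma>) * t powr (1 / \<sigma>) * ln t powr (1 / \<sigma>)) / ln t
        = \<sigma> / 2 * (4 / \<sigma>) powr (1 / \<sigma>) * t powr (1 / \<sigma>) * ln t powr (1 / \<sigma> - 1)"
      using lt by (simp add: powr_diff)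
    finally show ?thesis unfolding exp_le_cancel_iff neg_le_iff_le by (rule mult_left_mono) simp
  qed
  finally show ?thesis by (simp add: r_def t_def mult_ac)
qed

theorem proposition1p6:
  fixes \<sigma> :: real
  assumes "\<sigma> > 1 / 2"
  shows "\<exists>C\<^sub>1 > 0. \<exists>C\<^sub>2 > 0. \<forall>s. Re s = \<sigma> \<longrightarrow>
    (\<forall>\<^sub>F y in at_infinity.
       cmod (M_case1 s (Re y) (Im y))
         \<le> exp (- C\<^sub>1 * cmod y powr (1 / \<sigma>) * inverse (ln (cmod y))) \<and>
       cmod (M_case2 s (Re y) (Im y))
         \<le> exp (- C\<^sub>2 * cmod y powr (1 / \<sigma>) * ln (cmod y) powr (1 / \<sigma> - 1)))"
proof -
  obtain B where B: "B \<ge> 1" "\<And>X. X \<ge> 1 \<Longrightarrow> X \<le> real (card (prime_window B X)) * ln (B * X)"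
    using card_primes_1_mod_3_ge by blast
  define C1 where "C1 = (B powr - \<sigma> / 2)\<^sup>2 / 27 * (\<sigma> / 2)"
  define C2 where "C2 = (B powr - \<sigma> / 4)\<^sup>2 / 27 * (\<sigma> / 2 * (4 / \<sigma>) powr (1 / \<sigma>))"
  \<comment> \<open>The thresholds of both cases together; none of them involves the imaginary part
    of s.\<close>
  define l where "l = Max {\<sigma> * ln B + ln 2, ln 20, 2 * (\<sigma> * ln B + ln (4 / \<sigma>)), \<sigma>}"
  have pos: "C1 > 0" "C2 > 0" using B(1) assms by (auto simp: C1_def C2_def)
  have "filterlim (\<lambda>y::complex. ln (cmod y)) at_top at_infinity"
    by (rule filterlim_compose[OF ln_at_top filterlim_norm_at_top])
  then have ev: "\<forall>\<^sub>F y :: complex in at_infinity. l \<le> ln (cmod y)" by (simp add: filterlim_at_top)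
  have "\<forall>\<^sub>F y in at_infinity.
       cmod (M_case1 s (Re y) (Im y)) \<le> exp (- C1 * cmod y powr (1 / \<sigma>) * inverse (ln (cmod y))) \<and>
       cmod (M_case2 s (Re y) (Im y)) \<le> exp (- C2 * cmod y powr (1 / \<sigma>) * ln (cmod y) powr (1 / \<sigma> - 1))"
    if s: "Re s = \<sigma>" for s
    using ev
  proof eventually_elim
    case (elim y)
    then have y: "\<sigma> * ln B + ln 2 \<le> ln (cmod y)" "ln 20 \<le> ln (cmod y)"
      "2 * (\<sigma> * ln B + ln (4 / \<sigma>)) \<le> ln (cmod y)" "\<sigma> \<le> ln (cmod y)"
      by (simp_all add: l_def)
    show ?case
      using M_case1_bound[OF assms B s y(1,2)] M_case2_bound[OF assms B s y(3,2,4)]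
      unfolding C1_def C2_def by blast
  qed
  then show ?thesis using pos by blast
qed

end
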